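(* Let $n\ge 0$ be arbitrary. Margin weighting function for $\operatorname{HS}_n$: for all $x\in\mathbb{R}\setminus\{0\}$: a) For $x\in(-1-W(1/e),\,1+W(1/e))$, $(\operatorname{HS}_n)_x$ has exactly one maximum at the origin $(y,z)=(0,0)$. If $x<-1-W(1/e)$ or $x>1+W(1/e)$, $(\operatorname{HS}_n)_x$ has a saddle point at the origin and two extrema elsewhere. At these extrema, the elements of one diagonal (of the table) are equal, while at the other diagonal there is one (small) element. b) $(\operatorname{HS}_n)_x$ has the following limit functions: $$\lim_{\|(y,z)\|\to\infty}(\operatorname{HS}_n)_x=\operatorname{sign}\left(\tanh\tfrac x2\right)\left|\tanh\tfrac x2\right|^{\exp\left(n\left\{1+\log_2(1+e^x)-\frac{x}{\ln2\,(e^{-x}+1)}+p\log_2p+(1-p)\log_2(1-p)\right\}\right)},$$ where $p=(1+e^{x\pm z})^{-1}$ for $y\to\pm\infty$, or $p=(1+e^{x\pm y})^{-1}$ for $z\to\pm\infty$, respectively. Thus, the limit functions have an extremum at $p=0.5$, that is, $z=\mp x$ for $y\to\pm\infty$ and $y=\mp x$ for $z\to\pm\infty$, respectively. c) $\lim_{x\to\pm\infty}(\operatorname{HS}_n)_x=\pm1$. d) $(\operatorname{HS}_n)_x<Y_x$ at the margins, i.e. $\operatorname{HS}_n$ down-weights junk tables. e) $\operatorname{HS}_n$ can be extended completely to $\bar{\mathbb{R}}^3$. f) $\operatorname{HS}_n$ can be extended to $\overline{\mathbb{T}}$ except for edges and vertices corresponding to vanishing rows or columns. g) For all $x\in\mathbb{R}$,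 $\operatorname{HS}_n$ coincides with $Y$, $D^\prime$ and $r$ at diagonal tables.
   Context: $\mathbb{T}$ is the set of real $2\times2$ matrices $t=\begin{pmatrix}p_{00}&p_{01}\\ p_{10}&p_{11}\end{pmatrix}$ with all $p_{ij}>0$ and $\sum_{i,j}p_{ij}=1$; $p_{i.}=p_{i0}+p_{i1}$, $p_{.j}=p_{0j}+p_{1j}$. $\overline{\mathbb{T}}$ is its closure (all $p_{ij}\ge0$); the edges and vertices corresponding to vanishing rows or columns are the tables in $\overline{\mathbb{T}}$ having a row or a column consisting of zeros. Diagonal tables are those with $p_{00}=p_{11}$ and $p_{01}=p_{10}$. Junk tables are tables with almost vanishing rows or columns or single entries. With $\lambda=\frac{p_{00}p_{11}}{p_{01}p_{10}}$ (odds-ratio) and $D=p_{00}p_{11}-p_{01}p_{10}$: $Y=\frac{\sqrt\lambda-1}{\sqrt\lambda+1}$; $r=\frac{D}{\sqrt{p_{0.}p_{.0}p_{1.}p_{.1}}}$; $D^\prime=D/D_{max}$ with $D_{max}=\min\{p_{0.}p_{.1},p_{.0}p_{1.}\}$ if $D\ge0$ and $D_{max}=\min\{p_{0.}p_{.0},p_{1.}p_{.1}\}$ if $D<0$. The entropy is $H(t)=-\sum_{i,j}p_{ij}\log_2p_{ij}$, and $H_{diag}(t)$ is the entropy of the diagonal table of the same odds-ratio, $\frac{1}{2(1+\sqrt\lambda)}\begin{pmatrix}\sqrt\lambda&1\\1&\sqrt\lambda\end{pmatrix}$. Define $\operatorname{HS}_n=\operatorname{sign}(Y)\,|Y|^{\exp(n(H_{diag}-H))}$.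 Margin transformation coordinates on $\mathbb{T}$ are given by the diffeomorphism $\Psi:\mathbb{R}^3\to\mathbb{T}$, $\Psi(x,y,z)=\frac{1}{e^{x+y+z}+e^x+e^y+e^z}\begin{pmatrix}e^{x+y+z}&e^y\\ e^z&e^x\end{pmatrix}$, where $x=\ln\sqrt\lambda$; diagonal tables are those with $y=z=0$. For a function $\eta$ on $\mathbb{T}$ and fixed $x$, $\eta_x(y,z)=\eta(\Psi(x,y,z))$ is called the margin weighting function; in particular $Y_x=\tanh\frac x2$ is constant in $(y,z)$. "At the margins" refers to the limits $\|(y,z)\|\to\infty$ for finite $x$. $\bar{\mathbb{R}}=\mathbb{R}\cup\{-\infty,+\infty\}$ is the two-point compactification of $\mathbb{R}$, and $\bar{\mathbb{R}}^3$ compactifies the coordinate space $\mathbb{R}^3$ of $(x,y,z)$; "extended" means extended continuously. $W$ is Lambert's W-function, the inverse function of $w\mapsto we^w$; $W(1/e)$ is the unique real $w$ with $we^w=1/e$.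
   Formalization: Parts a) and d) are stated for n>0 only, since HS_0=Y is constant in (y,z); for x<0, where HS_n is negative, the maximum at the origin in a) becomes a minimum and the inequality in d) becomes (HS_n)_x>Y_x at the margins. *)

theory Defs
  imports "HOL-Analysis.Analysis"
begin

text \<open>The index type \<open>2\<close> has the elements \<open>0\<close> and \<open>1\<close>, so \<open>t $ i $ j\<close> is literally \<open>p\<^sub>i\<^sub>j\<close> with
  \<open>i, j \<in> {0, 1}\<close>.  (The library function \<open>vector\<close> is avoided: it enumerates this type as
  \<open>1, 2 = 0\<close>, which would swap rows and columns.)\<close>

type_synonym table = "real^2^2"

definition mk_table :: "real \<Rightarrow> real \<Rightarrow> real \<Rightarrow> real \<Rightarrow> table" where
  "mk_table a b c d =
     (\<chi> i j. if i = 0 then (if j = 0 then a else b) else (if j = 0 then c else d))"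

definition tables :: "table set" where
  "tables = {t. (\<forall>i j. 0 < t $ i $ j) \<and> (\<Sum>i\<in>UNIV. \<Sum>j\<in>UNIV. t $ i $ j) = 1}"

definition zero_row_or_column :: "table \<Rightarrow> bool" where
  "zero_row_or_column t \<longleftrightarrow> (\<exists>i. \<forall>j. t $ i $ j = 0) \<or> (\<exists>j. \<forall>i. t $ i $ j = 0)"

definition diagonal_table :: "table \<Rightarrow> bool" where
  "diagonal_table t \<longleftrightarrow> t $ 0 $ 0 = t $ 1 $ 1 \<and> t $ 0 $ 1 = t $ 1 $ 0"

definition row_sum :: "table \<Rightarrow> 2 \<Rightarrow> real" where
  "row_sum t i = (\<Sum>j\<in>UNIV. t $ i $ j)"

definition col_sum :: "table \<Rightarrow> 2 \<Rightarrow> real" where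
  "col_sum t j = (\<Sum>i\<in>UNIV. t $ i $ j)"

definition odds_ratio :: "table \<Rightarrow> real" where
  "odds_ratio t = (t $ 0 $ 0 * t $ 1 $ 1) / (t $ 0 $ 1 * t $ 1 $ 0)"

definition D_coeff :: "table \<Rightarrow> real" where
  "D_coeff t = t $ 0 $ 0 * t $ 1 $ 1 - t $ 0 $ 1 * t $ 1 $ 0"

definition Yule_Y :: "table \<Rightarrow> real" where
  "Yule_Y t = (sqrt (odds_ratio t) - 1) / (sqrt (odds_ratio t) + 1)"

definition corr_r :: "table \<Rightarrow> real" where
  "corr_r t = D_coeff t / sqrt (row_sum t 0 * col_sum t 0 * row_sum t 1 * col_sum t 1)"

definition D_max :: "table \<Rightarrow> real" where
  "D_max t =
     (if D_coeff t \<ge> 0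
      then min (row_sum t 0 * col_sum t 1) (col_sum t 0 * row_sum t 1)
      else min (row_sum t 0 * col_sum t 0) (row_sum t 1 * col_sum t 1))"

definition D_prime :: "table \<Rightarrow> real" where
  "D_prime t = D_coeff t / D_max t"

definition entropy2 :: "table \<Rightarrow> real" where
  "entropy2 t = - (\<Sum>i\<in>UNIV. \<Sum>j\<in>UNIV. t $ i $ j * log 2 (t $ i $ j))"

definition entropy_diag :: "table \<Rightarrow> real" where
  "entropy_diag t =
     (let s = sqrt (odds_ratio t)
      in entropy2 ((1 / (2 * (1 + s))) *\<^sub>R mk_table s 1 1 s))"

definition HS :: "real \<Rightarrow> table \<Rightarrow> real" where
  "HS n t = sgn (Yule_Y t) * \<bar>Yule_Y t\<bar> powr exp (n * (entropy_diag t - entropy2 t))"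

definition Psi :: "real \<times> real \<times> real \<Rightarrow> table" where
  "Psi = (\<lambda>(x, y, z). (1 / (exp (x + y + z) + exp x + exp y + exp z)) *\<^sub>R
            mk_table (exp (x + y + z)) (exp y) (exp z) (exp x))"

definition margin_weight :: "(table \<Rightarrow> real) \<Rightarrow> real \<Rightarrow> real \<times> real \<Rightarrow> real" where
  "margin_weight \<eta> x v = \<eta> (Psi (x, fst v, snd v))"

text \<open>Limit of \<open>margin_weight (HS n) x\<close> at the margins, as a function of the limiting proportion \<open>p\<close>
  in the row or column that does not vanish.\<close>

definition HS_limit :: "real \<Rightarrow> real \<Rightarrow> real \<Rightarrow> real" where
  "HS_limit n x p =
     sgn (tanh (x / 2)) * \<bar>tanh (x / 2)\<bar> powr
       exp (n * (1 + log 2 (1 + exp x) - x / (ln 2 * (exp (- x) + 1))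
                 + p * log 2 p + (1 - p) * log 2 (1 - p)))"

text \<open>Principal branch; at positive arguments \<open>w * exp w = a\<close> has no other real solution.\<close>

definition lambert_W :: "real \<Rightarrow> real" where
  "lambert_W a = (THE w. - 1 \<le> w \<and> w * exp w = a)"

definition local_max :: "('a::topological_space \<Rightarrow> real) \<Rightarrow> 'a \<Rightarrow> bool" where
  "local_max f p \<longleftrightarrow> (\<forall>\<^sub>F q in nhds p. f q \<le> f p)"

definition local_min :: "('a::topological_space \<Rightarrow> real) \<Rightarrow> 'a \<Rightarrow> bool" where
  "local_min f p \<longleftrightarrow> (\<forall>\<^sub>F q in nhds p. f p \<le> f q)"

definition local_extremum :: "('a::topological_space \<Rightarrow> real) \<Rightarrow> 'a \<Rightarrow> bool" where
  "local_extremum f p \<longleftrightarrow> local_max f p \<or> local_min f p"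

definition saddle_point :: "('a::real_normed_vector \<Rightarrow> real) \<Rightarrow> 'a \<Rightarrow> bool" where
  "saddle_point f p \<longleftrightarrow> (f has_derivative (\<lambda>_. 0)) (at p) \<and> \<not> local_extremum f p"

text \<open>"Exactly one maximum, located at \<open>p\<close>": the strict global maximum is at \<open>p\<close>, and there are
  no other local maxima.\<close>

definition only_max_at :: "('a::topological_space \<Rightarrow> real) \<Rightarrow> 'a \<Rightarrow> bool" where
  "only_max_at f p \<longleftrightarrow> (\<forall>q. q \<noteq> p \<longrightarrow> f q < f p) \<and> (\<forall>q. local_max f q \<longleftrightarrow> q = p)"

text \<open>For \<open>x < 0\<close> the function \<open>HS\<close> is negative, so statements on it about maxima or upper bounds,
  which concern its magnitude, become statements about minima or lower bounds.\<close>

definition only_min_at :: "('a::topological_space \<Rightarrow> real) \<Rightarrow> 'a \<Rightarrow> bool" where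
  "only_min_at f p \<longleftrightarrow> only_max_at (\<lambda>q. - f q) p"

text \<open>The entries of one diagonal are equal, and the other diagonal contains one small entry, i.e.
  one that is smaller than all three other entries of the table.\<close>

definition one_small_entry :: "table \<Rightarrow> bool" where
  "one_small_entry t \<longleftrightarrow>
     (t $ 0 $ 0 = t $ 1 $ 1 \<and>
       (t $ 0 $ 1 < min (t $ 1 $ 0) (t $ 0 $ 0) \<or> t $ 1 $ 0 < min (t $ 0 $ 1) (t $ 0 $ 0))) \<or>
     (t $ 0 $ 1 = t $ 1 $ 0 \<and>
       (t $ 0 $ 0 < min (t $ 1 $ 1) (t $ 0 $ 1) \<or> t $ 1 $ 1 < min (t $ 0 $ 0) (t $ 0 $ 1)))"

end

theory Submission
  imports Defs "HOL-Real_Asymp.Real_Asymp"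
begin

text \<open>At \<open>\<Psi>(x, y, z)\<close> the measure \<open>HS\<^sub>n\<close> is a signed power of \<open>Y = tanh (x/2)\<close> whose exponent decreases
  with the entropy \<open>H\<close>, so extrema in \<open>(y, z)\<close> are extrema of \<open>H\<close>. In logistic coordinates
  \<open>\<Psi>\<close> becomes a rational map of the unit cube, on which \<open>HS\<^sub>n\<close> is continuous; compactness then
  yields all limits at the margins. These lie strictly below \<open>Y\<close> in magnitude because a table with
  a vanishing row or column has \<open>H \<le> 1 < H\<^sub>d\<^sub>i\<^sub>a\<^sub>g\<close>, and therefore \<open>H\<close> attains its maximum.
  For \<open>x > 0\<close> every critical point of \<open>H\<close> has equal diagonal entries, that is \<open>z = - y\<close>, and then
  \<open>e\<^sup>x (x sinh y - y cosh y) = y\<close>. Besides \<open>y = 0\<close> this equation has no solution if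
  \<open>(x - 1) e\<^sup>x < 1\<close> and exactly one pair \<open>\<plusminus>y\<close> if \<open>(x - 1) e\<^sup>x > 1\<close>; the threshold is
  \<open>x = 1 + W(1/e)\<close>.\<close>

subsection \<open>Tables, entropies and signed powers\<close>

text \<open>No Hessian is computed. Below the threshold the origin is the only critical point of H,
  so the maximum, which exists, sits there. Above it, H increases from the origin along z = - y and
  decreases along z = y; the origin is therefore a saddle, and the maximum is forced onto the pair
  of roots. The threshold is where the derivative at y = 0 of e^x (x sinh y - y cosh y) - y, namely
  (x - 1) e^x - 1, changes sign; dividing (x - 1) e^x = 1 by e gives Lambert's equation for x - 1.
  Logistic coordinates suit the compactification because Y = 2a - 1 is affine in the coordinate a of
  x, and every entry becomes a product of coordinates or their complements over a common sum. For n
  = 0 the exponent is 1 and the function is constant in (y, z), so the strict claims in (a) and (d)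
  concern n > 0.\<close>

lemma sum_UNIV_2: "(\<Sum>i\<in>(UNIV::2 set). f i) = f 0 + (f 1 :: real)"
proof -
  \<comment> \<open>The library enumerates this index type as 1, 2, and modulo 2 the latter is
    0.\<close>
  have "(2::2) = 0" by simp
  then show ?thesis by (metis add.commute sum_2)
qed

lemma all_2_iff: "(\<forall>i::2. P i) \<longleftrightarrow> P 0 \<and> P 1"
proof -
  have "(2::2) = 0" by simp
  then show ?thesis by (metis forall_2)
qed

lemma ex_2_iff: "(\<exists>i::2. P i) \<longleftrightarrow> P 0 \<or> P 1"
  using all_2_iff[of "\<lambda>i. \<not> P i"] by blast

lemma mk_table_nth [simp]:
  "mk_table a b c d $ 0 $ 0 = a" "mk_table a b c d $ 0 $ 1 = b"
  "mk_table a b c d $ 1 $ 0 = c" "mk_table a b c d $ 1 $ 1 = d"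
  by (simp_all add: mk_table_def)

lemma scaleR_mk_table: "r *\<^sub>R mk_table a b c d = mk_table (r*a) (r*b) (r*c) (r*d)"
  by (simp add: mk_table_def vec_eq_iff)

lemma mk_table_eta: "mk_table (t$0$0) (t$0$1) (t$1$0) (t$1$1) = t"
  by (simp add: vec_eq_iff all_2_iff)

lemma tables_iff:
  "t \<in> tables \<longleftrightarrow> 0 < t$0$0 \<and> 0 < t$0$1 \<and> 0 < t$1$0 \<and> 0 < t$1$1 \<and>
     t$0$0 + t$0$1 + t$1$0 + t$1$1 = 1"
  by (auto simp: tables_def all_2_iff sum_UNIV_2)

lemma closure_tables:
  assumes "t \<in> closure tables"
  shows "0 \<le> t$i$j" "t$0$0 + t$0$1 + t$1$0 + t$1$1 = 1"
proof -
  let ?C = "{t::table. (\<forall>i j. 0 \<le> t$i$j) \<and> t$0$0 + t$0$1 + t$1$0 + t$1$1 = 1}"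
  have "closed ?C"
    by (intro closed_Collect_conj closed_Collect_all closed_Collect_le closed_Collect_eq
        continuous_intros)
  moreover have "tables \<subseteq> ?C"
  proof
    fix t :: table assume t: "t \<in> tables"
    then have "0 \<le> t $ i $ j" for i j by (auto simp: tables_def less_imp_le)
    with t show "t \<in> ?C" by (simp add: tables_iff)
  qed
  ultimately have "closure tables \<subseteq> ?C" by (rule closure_minimal[rotated])
  with assms show "0 \<le> t$i$j" "t$0$0 + t$0$1 + t$1$0 + t$1$1 = 1" by auto
qed

text \<open>The product vanishes at p = 0 whatever value the logarithm takes there, which is the
  value that makes entropy continuous up to zero entries.\<close>

definition plogp :: "real \<Rightarrow> real" where "plogp p = p * log 2 p"

lemma entropy2_eq:
  "entropy2 t = - (plogp (t$0$0) + plogp (t$0$1) + plogp (t$1$0) + plogp (t$1$1))"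
  by (simp add: entropy2_def sum_UNIV_2 plogp_def)

lemma plogp_0_1 [simp]: "plogp 0 = 0" "plogp 1 = 0"
  by (simp_all add: plogp_def)

lemma continuous_on_plogp: "continuous_on {0..} plogp"
proof (subst continuous_on_eq_continuous_within, intro ballI)
  fix p :: real assume p: "p \<in> {0..}"
  show "continuous (at p within {0..}) plogp"
  proof (cases "p = 0")
    case False
    then have "isCont plogp p"
      unfolding plogp_def by (intro continuous_intros) auto
    then show ?thesis by (rule continuous_at_imp_continuous_at_within)
  next
    case True
    have "((\<lambda>p::real. p * log 2 p) \<longlongrightarrow> 0) (at_right 0)"
      unfolding log_def by real_asymp
    then show ?thesis unfolding True continuous_within plogp_def
      by (simp add: at_within_Ici_at_right)
  qed
qed

lemma continuous_on_plogp_comp: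
  assumes "continuous_on S f" "\<And>x. x \<in> S \<Longrightarrow> 0 \<le> f x"
  shows "continuous_on S (\<lambda>x. plogp (f x))"
  by (rule continuous_on_compose2[OF continuous_on_plogp]) (use assms in auto)

text \<open>The constant 2 is crude: ln (1/p) \<le> 1/p - 1 gives p ln p \<ge> -1, and ln 2 \<ge>
  1/2. Only some finite bound matters later.\<close>

lemma plogp_bounds:
  assumes "0 \<le> p" "p \<le> 1"
  shows "plogp p \<le> 0" "- 2 \<le> plogp p"
proof -
  show "plogp p \<le> 0" using assms
    by (cases "p = 0") (auto simp: plogp_def mult_nonneg_nonpos)
  show "- 2 \<le> plogp p"
  proof (cases "p = 0")
    case False
    with assms have p: "0 < p" by simp
    have "ln (1 / p) \<le> 1 / p - 1" using p by (intro ln_le_minus_one) simp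
    then have "p * (- ln p) \<le> p * (1 / p - 1)"
      using p by (intro mult_left_mono) (auto simp: ln_div)
    also have "\<dots> \<le> 1" using p by (simp add: algebra_simps)
    finally have "- 1 \<le> p * ln p" by simp
    moreover have "1 / 2 \<le> ln (2::real)" using ln2_ge_two_thirds by simp
    ultimately have "- (2 * ln 2) \<le> p * ln p" by linarith
    then show ?thesis by (simp add: plogp_def log_def field_simps)
  qed auto
qed

definition spow :: "real \<Rightarrow> real \<Rightarrow> real" where
  "spow y e = sgn y * \<bar>y\<bar> powr e"

text \<open>The sign function jumps at 0, whereas positive powers of the positive and negative parts
  are continuous; this form is the source of \<open>continuous_on_spow\<close>.\<close>

lemma spow_altdef: "spow y e = max y 0 powr e - max (- y) 0 powr e"
  by (cases "y > 0"; cases "y < 0") (auto simp: spow_def max_def)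

lemma spow_minus: "spow (- y) e = - spow y e"
  by (simp add: spow_def)

lemma spow_1_right [simp]: "spow y 1 = y"
  by (simp add: spow_def abs_mult_sgn mult.commute[of "sgn y"])

lemma spow_1_left [simp]: "spow 1 e = 1" "spow (- 1) e = - 1"
  by (simp_all add: spow_def)

lemma continuous_on_spow:
  assumes "continuous_on S f" "continuous_on S g" "\<And>x. x \<in> S \<Longrightarrow> 0 < g x"
  shows "continuous_on S (\<lambda>x. spow (f x) (g x))"
  unfolding spow_altdef using assms
  by (intro continuous_intros continuous_on_powr') auto

lemma spow_ge:
  assumes "0 \<le> y" "y \<le> 1" "0 < e" "e \<le> E"
  shows "y powr E \<le> spow y e" "spow y e \<le> 1"
proof -
  show "spow y e \<le> 1" using assms powr_le1[of e y] by (auto simp: spow_def sgn_if)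
  show "y powr E \<le> spow y e"
    using assms powr_mono'[of e E y] by (cases "y = 0") (auto simp: spow_def sgn_if)
qed

text \<open>The entropy of the diagonal table with \<open>Y\<close>-coefficient \<open>y\<close>, whose entries are
  \<open>(1 \<plusminus> y) / 4\<close>.\<close>

definition hdiag :: "real \<Rightarrow> real" where
  "hdiag y = - 2 * (plogp ((1 + y) / 4) + plogp ((1 - y) / 4))"

lemma hdiag_minus: "hdiag (- y) = hdiag y"
  by (simp add: hdiag_def)

text \<open>Four entries, each contributing at most 2 by \<open>plogp_bounds\<close>, give
  8.\<close>

lemma hdiag_le:
  assumes "- 1 \<le> y" "y \<le> 1" shows "hdiag y \<le> 8"
  using plogp_bounds[of "(1 + y) / 4"] plogp_bounds[of "(1 - y) / 4"] assms
  by (simp add: hdiag_def)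

lemma continuous_on_hdiag: "continuous_on {-1..1} hdiag"
  unfolding hdiag_def
  by (intro continuous_intros continuous_on_plogp_comp) auto

lemma entropy2_nonneg:
  assumes "\<And>i j. 0 \<le> t$i$j" "\<And>i j. t$i$j \<le> 1" shows "0 \<le> entropy2 t"
  using plogp_bounds[of "t$0$0"] plogp_bounds[of "t$0$1"] plogp_bounds[of "t$1$0"]
    plogp_bounds[of "t$1$1"] assms by (simp add: entropy2_eq)

lemma continuous_on_entropy2:
  assumes "continuous_on S f" "\<And>x i j. x \<in> S \<Longrightarrow> 0 \<le> f x $ i $ j"
  shows "continuous_on S (\<lambda>x. entropy2 (f x))"
  unfolding entropy2_eq using assms
  by (intro continuous_intros continuous_on_plogp_comp) auto

text \<open>The value of Y is passed separately from the table: on faces of the cube the limiting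
  table no longer determines its odds-ratio, but Y is still known from x.\<close>

definition HS_of :: "real \<Rightarrow> real \<Rightarrow> table \<Rightarrow> real" where
  "HS_of n y t = spow y (exp (n * (hdiag y - entropy2 t)))"

lemma entropy_diag_eq:
  assumes "0 \<le> odds_ratio t" shows "entropy_diag t = hdiag (Yule_Y t)"
proof -
  define s where "s = sqrt (odds_ratio t)"
  have s: "s \<ge> 0" using assms by (simp add: s_def)
  have e: "(1 + Yule_Y t) / 4 = 1 / (2 * (1 + s)) * s" "(1 - Yule_Y t) / 4 = 1 / (2 * (1 + s)) * 1"
    using s unfolding Yule_Y_def s_def[symmetric] by (auto simp: field_simps)
  show ?thesis
    unfolding entropy_diag_def hdiag_def e Let_def s_def[symmetric] scaleR_mk_table entropy2_eq
    by simp
qed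

lemma HS_eq:
  assumes "0 \<le> odds_ratio t" shows "HS n t = HS_of n (Yule_Y t) t"
  by (simp add: HS_def HS_of_def spow_def entropy_diag_eq[OF assms])

lemma odds_ratio_pos: "t \<in> tables \<Longrightarrow> 0 < odds_ratio t"
  by (simp add: tables_iff odds_ratio_def)

lemma Yule_Y_bounds:
  assumes "0 \<le> odds_ratio t" shows "- 1 \<le> Yule_Y t" "Yule_Y t \<le> 1"
proof -
  define s where "s = sqrt (odds_ratio t)"
  have "s \<ge> 0" using assms by (simp add: s_def)
  then show "- 1 \<le> Yule_Y t" "Yule_Y t \<le> 1"
    unfolding Yule_Y_def s_def[symmetric] by (auto simp: field_simps)
qed

lemma continuous_on_HS_of:
  assumes "continuous_on S f" "continuous_on S g"
    "\<And>x. x \<in> S \<Longrightarrow> - 1 \<le> f x \<and> f x \<le> 1" "\<And>x i j. x \<in> S \<Longrightarrow> 0 \<le> g x $ i $ j"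
  shows "continuous_on S (\<lambda>x. HS_of n (f x) (g x))"
proof -
  have "continuous_on S (\<lambda>x. hdiag (f x))"
    by (rule continuous_on_compose2[OF continuous_on_hdiag assms(1)]) (use assms in auto)
  then show ?thesis unfolding HS_of_def
    by (intro continuous_on_spow continuous_intros continuous_on_entropy2 assms) auto
qed

text \<open>The entropy difference is at most 8 - 0, so the exponent of Y is bounded independently
  of the table. Whenever Y tends to 1, both bounds do as well.\<close>

lemma HS_of_bounds:
  assumes "n \<ge> 0" "0 \<le> y" "y \<le> 1" "\<And>i j. 0 \<le> t$i$j" "\<And>i j. t$i$j \<le> 1"
  shows "y powr exp (8 * n) \<le> HS_of n y t" "HS_of n y t \<le> 1"
proof -
  have "hdiag y - entropy2 t \<le> 8"
    using hdiag_le[of y] entropy2_nonneg[of t] assms by simp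
  then have "n * (hdiag y - entropy2 t) \<le> 8 * n"
    using assms(1) mult_left_mono[of "hdiag y - entropy2 t" 8 n] by simp
  then have "exp (n * (hdiag y - entropy2 t)) \<le> exp (8 * n)" by simp
  then show "y powr exp (8 * n) \<le> HS_of n y t" "HS_of n y t \<le> 1"
    unfolding HS_of_def using spow_ge[OF assms(2,3) exp_gt_zero] by auto
qed

lemma HS_of_minus: "HS_of n (- y) t = - HS_of n y t"
  by (simp add: HS_of_def spow_minus hdiag_minus)

lemma HS_of_bounds_neg:
  assumes "n \<ge> 0" "y \<le> 0" "- 1 \<le> y" "\<And>i j. 0 \<le> t$i$j" "\<And>i j. t$i$j \<le> 1"
  shows "HS_of n y t \<le> - ((- y) powr exp (8 * n))" "- 1 \<le> HS_of n y t"
  using HS_of_bounds[of n "- y" t] assms by (auto simp: HS_of_minus)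

subsection \<open>Compactification by logistic coordinates\<close>

definition logistic :: "real \<Rightarrow> real" where "logistic x = exp x / (1 + exp x)"

lemma exp_add_1_pos: "0 < 1 + exp (x::real)" "1 + exp (x::real) \<noteq> 0"
  by (smt (verit) exp_gt_zero)+

lemma logistic_bounds: "0 < logistic x" "logistic x < 1"
  using exp_add_1_pos[of x] by (simp_all add: logistic_def field_simps)

lemma logistic_in [simp]: "logistic x \<in> {0..1}"
  using logistic_bounds[of x] by simp

lemma one_minus_logistic: "1 - logistic x = 1 / (1 + exp x)"
  using exp_add_1_pos[of x] by (simp add: logistic_def field_simps)

lemma logistic_at_top: "(logistic \<longlongrightarrow> 1) at_top"
  unfolding logistic_def by real_asymp

lemma logistic_at_bot: "(logistic \<longlongrightarrow> 0) at_bot"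
  unfolding logistic_def by real_asymp

lemma isCont_logistic: "isCont logistic x"
  unfolding logistic_def[abs_def] using exp_add_1_pos[of x] by (intro continuous_intros) auto

text \<open>Carries the two-point compactification of the line continuously to [0, 1], so that
  continuous functions on the closed cube pull back to extensions in the sense of (e).\<close>

definition ereal_logistic :: "ereal \<Rightarrow> real" where
  "ereal_logistic x = (case x of ereal r \<Rightarrow> logistic r | PInfty \<Rightarrow> 1 | MInfty \<Rightarrow> 0)"

lemma ereal_logistic_simps [simp]: "ereal_logistic (ereal r) = logistic r" "ereal_logistic \<infinity> = 1" "ereal_logistic (-\<infinity>) = 0"
  by (simp_all add: ereal_logistic_def)

lemma ereal_logistic_in: "ereal_logistic x \<in> {0..1}"
  by (cases x) (use logistic_in in auto)

lemma at_MInfty_ereal: "at (-\<infinity>::ereal) = filtermap ereal at_bot"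
proof -
  have "at (-\<infinity>::ereal) = at_right (-\<infinity>)"
    by (rule at_within_nhd[of _ UNIV]) auto
  then show ?thesis by (simp add: at_right_MInf)
qed

lemma continuous_on_ereal_logistic: "continuous_on UNIV ereal_logistic"
proof (subst continuous_on_eq_continuous_at[OF open_UNIV], intro ballI)
  fix x :: ereal
  have "(ereal_logistic \<longlongrightarrow> ereal_logistic x) (at x)"
  proof (cases x)
    case (real r)
    show ?thesis
      unfolding real at_ereal filterlim_filtermap using isCont_logistic[of r] by (simp add: isCont_def)
  next
    case PInf
    then show ?thesis
      using logistic_at_top by (simp add: at_infty_ereal_eq_at_top filterlim_filtermap)
  next
    case MInf
    then show ?thesis
      using logistic_at_bot by (simp add: at_MInfty_ereal filterlim_filtermap)
  qed
  then show "isCont ereal_logistic x" by (simp add: isCont_def)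
qed

text \<open>Substituting e^x = a/(1-a), e^y = u/(1-u), e^z = w/(1-w) into the unnormalized entries
  of \<open>Psi\<close> and multiplying by (1-a)(1-u)(1-w) leaves these four products, which also
  make sense on the boundary of the cube.\<close>

definition cube_den :: "real \<Rightarrow> real \<Rightarrow> real \<Rightarrow> real" where
  "cube_den a u w = a*u*w + (1-a)*u*(1-w) + (1-a)*(1-u)*w + a*(1-u)*(1-w)"

definition cube_table :: "real \<Rightarrow> real \<Rightarrow> real \<Rightarrow> table" where
  "cube_table a u w = mk_table (a*u*w / cube_den a u w) ((1-a)*u*(1-w) / cube_den a u w)
     ((1-a)*(1-u)*w / cube_den a u w) (a*(1-u)*(1-w) / cube_den a u w)"

lemma Psi_eq_cube_table: "Psi (x, y, z) = cube_table (logistic x) (logistic y) (logistic z)"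
proof -
  define X Y Z where "X = exp x" "Y = exp y" "Z = exp z"
  have pos: "0 < X" "0 < Y" "0 < Z" by (simp_all add: X_Y_Z_def)
  define c where "c = 1 / ((1+X)*(1+Y)*(1+Z))"
  have c: "c > 0" using pos by (simp add: c_def)
  have s: "logistic x = X / (1+X)" "logistic y = Y / (1+Y)" "logistic z = Z / (1+Z)"
    "1 - logistic x = 1 / (1+X)" "1 - logistic y = 1 / (1+Y)" "1 - logistic z = 1 / (1+Z)"
    unfolding one_minus_logistic by (simp_all add: logistic_def X_Y_Z_def)
  have e: "logistic x * logistic y * logistic z = (X*Y*Z)*c" "(1-logistic x) * logistic y * (1-logistic z) = Y*c"
     "(1-logistic x) * (1-logistic y) * logistic z = Z*c" "logistic x * (1-logistic y) * (1-logistic z) = X*c"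
    unfolding s(4-6) unfolding s(1-3) c_def by simp_all
  have d: "cube_den (logistic x) (logistic y) (logistic z) = (X*Y*Z + X + Y + Z) * c"
    unfolding cube_den_def e by (simp add: algebra_simps)
  show ?thesis using c
    by (simp add: Psi_def cube_table_def d e scaleR_mk_table exp_add X_Y_Z_def[symmetric])
qed

lemma cube_entries_nonneg:
  assumes "a \<in> {0..1}" "u \<in> {0..1}" "w \<in> {0..1::real}"
  shows "0 \<le> a*u*w" "0 \<le> (1-a)*u*(1-w)" "0 \<le> (1-a)*(1-u)*w" "0 \<le> a*(1-u)*(1-w)"
  using assms by auto

text \<open>Corners with vanishing denominator are included: there division by 0 makes all entries
  0, so the entropy bounds hold on the whole closed cube.\<close>

lemma cube_table_bounds:
  assumes "a \<in> {0..1}" "u \<in> {0..1}" "w \<in> {0..1}"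
  shows "0 \<le> cube_table a u w $ i $ j" "cube_table a u w $ i $ j \<le> 1"
proof -
  note nn = cube_entries_nonneg[OF assms]
  have d: "0 \<le> cube_den a u w" using nn by (simp add: cube_den_def)
  have "\<forall>i j. 0 \<le> cube_table a u w $ i $ j"
    using nn d by (auto simp: all_2_iff cube_table_def)
  then show "0 \<le> cube_table a u w $ i $ j" by blast
  have "p / cube_den a u w \<le> 1" if "p \<le> cube_den a u w" for p
    using that d by (cases "cube_den a u w = 0") (auto simp: field_simps)
  then have "\<forall>i j. cube_table a u w $ i $ j \<le> 1"
    using nn by (simp add: all_2_iff cube_table_def cube_den_def)
  then show "cube_table a u w $ i $ j \<le> 1" by blast
qed

text \<open>The denominator is the convex combination, with weights a and 1 - a, of q = uw +
  (1-u)(1-w) and 1 - q. These are nonnegative and not both 0, and both weights are positive.\<close>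

lemma cube_den_pos:
  assumes "0 < a" "a < 1" "u \<in> {0..1}" "w \<in> {0..1}"
  shows "0 < cube_den a u w"
proof -
  define q where "q = u*w + (1-u)*(1-w)"
  have q: "0 \<le> q" "0 \<le> 1 - q"
  proof -
    show "0 \<le> q" using assms by (simp add: q_def)
    have "1 - q = u*(1-w) + (1-u)*w" by (simp add: q_def algebra_simps)
    then show "0 \<le> 1 - q" using assms by simp
  qed
  have "cube_den a u w = a * q + (1 - a) * (1 - q)"
    by (simp add: cube_den_def q_def algebra_simps)
  moreover have "0 < a * q + (1 - a) * (1 - q)"
  proof (cases "q = 0")
    case False
    then show ?thesis using q assms by (intro add_pos_nonneg) auto
  qed (use assms in auto)
  ultimately show ?thesis by simp
qed

definition cube_HS :: "real \<Rightarrow> real \<times> real \<times> real \<Rightarrow> real" where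
  "cube_HS n = (\<lambda>(a, u, w). HS_of n (2 * a - 1) (cube_table a u w))"

abbreviation "unit_cube \<equiv> {0..1::real} \<times> {0..1::real} \<times> {0..1::real}"

lemma continuous_on_mk_table [continuous_intros]:
  assumes "continuous_on S a" "continuous_on S b" "continuous_on S c" "continuous_on S d"
  shows "continuous_on S (\<lambda>x. mk_table (a x) (b x) (c x) (d x))"
  unfolding mk_table_def
proof (intro continuous_on_vec_lambda)
  fix i j :: 2
  show "continuous_on S
      (\<lambda>x. if i = 0 then if j = 0 then a x else b x else if j = 0 then c x else d x)"
    by (cases "i = 0"; cases "j = 0") (use assms in auto)
qed

lemma continuous_on_cube_HS_interior:
  "continuous_on ({0<..<1} \<times> {0..1} \<times> {0..1}) (cube_HS n)"
  unfolding cube_HS_def case_prod_beta'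
proof (intro continuous_on_HS_of)
  have "cube_den (fst p) (fst (snd p)) (snd (snd p)) \<noteq> 0"
    if "p \<in> {0<..<1} \<times> {0..1} \<times> {0..1}" for p
    using that cube_den_pos[of "fst p" "fst (snd p)" "snd (snd p)"] by auto
  then show "continuous_on ({0<..<1} \<times> {0..1} \<times> {0..1})
     (\<lambda>p. cube_table (fst p) (fst (snd p)) (snd (snd p)))"
    unfolding cube_table_def by (auto simp: cube_den_def intro!: continuous_intros)
qed (auto intro!: continuous_intros cube_table_bounds)

text \<open>Near \<open>a = 0\<close> and \<open>a = 1\<close> the tables need not converge, but since entropies are bounded the
  exponent of \<open>\<bar>Y\<bar>\<close> is, and \<open>\<bar>Y\<bar>\<close> tends to \<open>1\<close>.\<close>

lemma continuous_on_cube_HS: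
  assumes "n \<ge> 0" shows "continuous_on unit_cube (cube_HS n)"
proof (subst continuous_on_eq_continuous_within, intro ballI)
  fix p0 assume p0: "p0 \<in> unit_cube"
  have ev: "\<forall>\<^sub>F p in at p0 within unit_cube. p \<in> unit_cube"
    by (simp add: eventually_at_filter)
  have lim: "((\<lambda>p. fst p) \<longlongrightarrow> fst p0) (at p0 within unit_cube)"
    by (intro tendsto_intros)
  consider "fst p0 = 0" | "fst p0 = 1" | "0 < fst p0" "fst p0 < 1" using p0 by force
  then show "continuous (at p0 within unit_cube) (cube_HS n)"
  proof cases
    case 1
    have "\<forall>\<^sub>F p in at p0 within unit_cube. fst p < 1/2"
      using order_tendstoD(2)[OF lim, of "1/2"] 1 by simp
    with ev have b: "\<forall>\<^sub>F p in at p0 within unit_cube.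
        - 1 \<le> cube_HS n p \<and> cube_HS n p \<le> - ((- (2 * fst p - 1)) powr exp (8 * n))"
    proof eventually_elim
      case (elim p)
      then show ?case
        using HS_of_bounds_neg[OF assms, of "2 * fst p - 1"
            "cube_table (fst p) (fst (snd p)) (snd (snd p))"]
          cube_table_bounds[of "fst p" "fst (snd p)" "snd (snd p)"]
        by (auto simp: cube_HS_def case_prod_beta)
    qed
    have "((\<lambda>p. - (2 * fst p - 1)) \<longlongrightarrow> - (2 * fst p0 - 1)) (at p0 within unit_cube)"
      by (intro tendsto_intros lim)
    then have "((\<lambda>p. (- (2 * fst p - 1)) powr exp (8 * n)) \<longlongrightarrow> 1 powr exp (8 * n))
        (at p0 within unit_cube)"
      using 1 by (intro tendsto_powr tendsto_const) auto
    then have "((\<lambda>p. - ((- (2 * fst p - 1)) powr exp (8 * n))) \<longlongrightarrow> - 1)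
        (at p0 within unit_cube)"
      unfolding powr_one_eq_one by (rule tendsto_minus)
    then have "(cube_HS n \<longlongrightarrow> - 1) (at p0 within unit_cube)"
      by (rule tendsto_sandwich[OF _ _ tendsto_const, rotated 2])
        (rule eventually_mono[OF b], blast)+
    moreover have "cube_HS n p0 = - 1"
      using 1 by (simp add: cube_HS_def case_prod_beta HS_of_def)
    ultimately show ?thesis by (simp add: continuous_within)
  next
    case 2
    have "\<forall>\<^sub>F p in at p0 within unit_cube. fst p > 1/2"
      using order_tendstoD(1)[OF lim, of "1/2"] 2 by simp
    with ev have b: "\<forall>\<^sub>F p in at p0 within unit_cube.
        (2 * fst p - 1) powr exp (8 * n) \<le> cube_HS n p \<and> cube_HS n p \<le> 1"
    proof eventually_elim
      case (elim p)
      then show ?case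
        using HS_of_bounds[OF assms, of "2 * fst p - 1"
            "cube_table (fst p) (fst (snd p)) (snd (snd p))"]
          cube_table_bounds[of "fst p" "fst (snd p)" "snd (snd p)"]
        by (auto simp: cube_HS_def case_prod_beta)
    qed
    have "((\<lambda>p. 2 * fst p - 1) \<longlongrightarrow> 2 * fst p0 - 1) (at p0 within unit_cube)"
      by (intro tendsto_intros lim)
    then have "((\<lambda>p. (2 * fst p - 1) powr exp (8 * n)) \<longlongrightarrow> 1 powr exp (8 * n))
        (at p0 within unit_cube)"
      using 2 by (intro tendsto_powr tendsto_const) auto
    then have "((\<lambda>p. (2 * fst p - 1) powr exp (8 * n)) \<longlongrightarrow> 1) (at p0 within unit_cube)"
      unfolding powr_one_eq_one .
    then have "(cube_HS n \<longlongrightarrow> 1) (at p0 within unit_cube)"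
      by (rule tendsto_sandwich[OF _ _ _ tendsto_const, rotated 2])
        (rule eventually_mono[OF b], blast)+
    moreover have "cube_HS n p0 = 1"
      using 2 by (simp add: cube_HS_def case_prod_beta HS_of_def)
    ultimately show ?thesis by (simp add: continuous_within)
  next
    case 3
    have "at p0 within unit_cube = at p0 within ({0<..<1} \<times> {0..1} \<times> {0..1})"
      by (rule at_within_nhd[of _ "{0<..<1} \<times> UNIV"]) (use 3 in \<open>auto simp: open_Times mem_Times_iff\<close>)
    moreover have "p0 \<in> {0<..<1} \<times> {0..1} \<times> {0..1}" using 3 p0 by (auto simp: mem_Times_iff)
    ultimately show ?thesis
      using continuous_on_cube_HS_interior[of n] unfolding continuous_on_eq_continuous_within
      by metis
  qed
qed

section \<open>Entries, odds-ratio and Y in margin coordinates\<close>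

lemma Psi_nth:
  fixes x y z :: real
  defines "N \<equiv> exp (x + y + z) + exp x + exp y + exp z"
  shows "Psi (x, y, z) $ 0 $ 0 = exp (x + y + z) / N" "Psi (x, y, z) $ 0 $ 1 = exp y / N"
    "Psi (x, y, z) $ 1 $ 0 = exp z / N" "Psi (x, y, z) $ 1 $ 1 = exp x / N" "0 < N"
proof -
  show "0 < N" unfolding N_def by (intro add_pos_pos) auto
qed (simp_all add: Psi_def N_def scaleR_mk_table)

lemma Psi_in_tables: "Psi (x, y, z) \<in> tables"
proof -
  define N where "N = exp (x + y + z) + exp x + exp y + exp z"
  have "N > 0" using Psi_nth(5)[of x y z] by (simp add: N_def)
  moreover have "exp (x + y + z) / N + exp y / N + exp z / N + exp x / N = 1"
    using \<open>N > 0\<close> by (simp add: add_divide_distrib[symmetric]) (simp add: N_def)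
  ultimately show ?thesis
    unfolding tables_iff Psi_nth N_def[symmetric] by simp
qed

lemma odds_ratio_Psi: "odds_ratio (Psi (x, y, z)) = (exp x)\<^sup>2"
proof -
  define N where "N = exp (x + y + z) + exp x + exp y + exp z"
  have "N > 0" using Psi_nth(5)[of x y z] by (simp add: N_def)
  then show ?thesis
    unfolding odds_ratio_def Psi_nth N_def[symmetric]
    by (simp add: field_simps exp_add power2_eq_square)
qed

lemma tanh_half: "tanh (x / 2) = (exp x - 1) / (exp x + 1)" for x :: real
proof -
  define X where "X = exp x"
  have X: "X > 0" by (simp add: X_def)
  have "tanh (x / 2) = (1 - 1 / X) / (1 + 1 / X)"
    by (simp add: tanh_real_altdef exp_minus X_def inverse_eq_divide)
  also have "\<dots> = (X - 1) / (X + 1)"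
    using X by (simp add: divide_simps)
  finally show ?thesis by (simp add: X_def)
qed

lemma Yule_Y_Psi: "Yule_Y (Psi (x, y, z)) = tanh (x / 2)"
  by (simp add: Yule_Y_def odds_ratio_Psi tanh_half)

lemma tanh_half_eq: "tanh (x / 2) = 2 * logistic x - 1"
  using exp_add_1_pos[of x] by (simp add: logistic_def tanh_half field_simps)

lemma HS_Psi: "HS n (Psi (x, y, z)) = HS_of n (tanh (x / 2)) (Psi (x, y, z))"
  by (subst HS_eq) (simp_all add: odds_ratio_Psi Yule_Y_Psi)

lemma HS_Psi_cube: "HS n (Psi (x, y, z)) = cube_HS n (logistic x, logistic y, logistic z)"
  unfolding HS_Psi by (simp add: cube_HS_def tanh_half_eq Psi_eq_cube_table)

lemma HS_extends_compactification:
  assumes "n \<ge> 0"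
  shows "\<exists>F :: ereal \<times> ereal \<times> ereal \<Rightarrow> real. continuous_on UNIV F \<and>
          (\<forall>x y z. F (ereal x, ereal y, ereal z) = HS n (Psi (x, y, z)))"
proof (intro exI conjI allI)
  show "continuous_on UNIV (\<lambda>p. cube_HS n (ereal_logistic (fst p), ereal_logistic (fst (snd p)), ereal_logistic (snd (snd p))))"
    using ereal_logistic_in by (intro continuous_on_compose2[OF continuous_on_cube_HS[OF assms]]
       continuous_intros continuous_on_compose2[OF continuous_on_ereal_logistic]) auto
qed (simp add: HS_Psi_cube)

subsection \<open>Limits at the margins\<close>

text \<open>Uniform continuity on the compact square makes the convergence in one coordinate uniform
  in the other.\<close>

lemma uniform_limit_compact_square:
  fixes K :: "real \<times> real \<Rightarrow> real"
  assumes K: "continuous_on ({0..1} \<times> {0..1}) K" and f: "(f \<longlongrightarrow> c) F"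
    and "c \<in> {0..1}" "\<And>y. f y \<in> {0..1}" "\<And>z. g z \<in> {0..1}"
  shows "uniform_limit UNIV (\<lambda>y z. K (f y, g z)) (\<lambda>z. K (c, g z)) F"
proof (rule uniform_limitI)
  fix e :: real assume "e > 0"
  have "uniformly_continuous_on ({0..1} \<times> {0..1}) K"
    by (intro compact_uniformly_continuous K compact_Times) auto
  then obtain d where d: "d > 0"
    "\<And>p q. p \<in> {0..1} \<times> {0..1} \<Longrightarrow> q \<in> {0..1} \<times> {0..1} \<Longrightarrow> dist q p < d \<Longrightarrow> dist (K q) (K p) < e"
    unfolding uniformly_continuous_on_def using \<open>e > 0\<close> by metis
  have "\<forall>\<^sub>F y in F. dist (f y) c < d" using f \<open>d > 0\<close> by (rule tendstoD)
  then show "\<forall>\<^sub>F y in F. \<forall>z\<in>UNIV. dist (K (f y, g z)) (K (c, g z)) < e"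
    by eventually_elim (use assms(3-5) in \<open>auto intro!: d(2) simp: dist_Pair_Pair\<close>)
qed

text \<open>With y = 2s - 1 the diagonal table has entries s/2 and (1-s)/2, each twice: one bit for
  the row plus the binary entropy of s.\<close>

lemma hdiag_altdef:
  assumes "0 < s" "s < 1"
  shows "hdiag (2 * s - 1) = 1 - plogp s - plogp (1 - s)"
proof -
  have e: "(1 + (2 * s - 1)) / 4 = s / 2" "(1 - (2 * s - 1)) / 4 = (1 - s) / 2" by auto
  have "plogp (q / 2) = plogp q / 2 - q / 2" if "0 < q" for q
    using that by (simp add: plogp_def log_divide field_simps)
  from this[of s] this[of "1 - s"] show ?thesis
    unfolding hdiag_def e using assms by argo
qed

lemma plogp_neg: "0 < p \<Longrightarrow> p < 1 \<Longrightarrow> plogp p < 0"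
  by (simp add: plogp_def mult_pos_neg)

text \<open>The binary entropy added to the one bit is strictly positive for finite x. This gap is
  what makes the inequality (d) strict.\<close>

lemma hdiag_tanh_gt: "1 < hdiag (tanh (x / 2))"
  using plogp_neg[of "logistic x"] plogp_neg[of "1 - logistic x"] logistic_bounds[of x]
  by (simp add: tanh_half_eq hdiag_altdef)

lemma hdiag_tanh: "hdiag (tanh (x / 2)) = 1 + log 2 (1 + exp x) - x / (ln 2 * (exp (- x) + 1))"
proof -
  have pos: "0 < 1 + exp x" by (rule exp_add_1_pos)
  have l: "log 2 (logistic x) = x / ln 2 - log 2 (1 + exp x)" "log 2 (1 - logistic x) = - log 2 (1 + exp x)"
    unfolding one_minus_logistic using pos by (simp_all add: logistic_def log_def ln_div diff_divide_distrib)
  have s: "1 / (exp (- x) + 1) = logistic x"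
    using pos by (simp add: logistic_def exp_minus field_simps)
  have "hdiag (tanh (x / 2)) = 1 - logistic x * log 2 (logistic x) - (1 - logistic x) * log 2 (1 - logistic x)"
    unfolding tanh_half_eq using logistic_bounds[of x] by (simp add: hdiag_altdef plogp_def)
  also have "\<dots> = 1 + log 2 (1 + exp x) - logistic x * (x / ln 2)"
    unfolding l by (simp add: algebra_simps)
  also have "logistic x * (x / ln 2) = x / (ln 2 * (exp (- x) + 1))"
    unfolding s[symmetric] by simp
  finally show ?thesis .
qed

lemma HS_limit_eq:
  "HS_limit n x p = spow (tanh (x / 2)) (exp (n * (hdiag (tanh (x / 2)) + plogp p + plogp (1 - p))))"
  by (simp add: HS_limit_def hdiag_tanh spow_def plogp_def)

lemma binary_entropy_le:
  assumes "0 < p" "p < 1" shows "- 1 \<le> plogp p + plogp (1 - p)"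
proof -
  \<comment> \<open>The right-hand side is the tangent of -p ln p at p = 1/2; adding the instances
    at p and 1 - p leaves exactly ln 2.\<close>
  have *: "- (p * ln p) \<le> p * ln 2 + 1 / 2 - p" if "0 < p" for p :: real
  proof -
    have "ln (1 / (2 * p)) \<le> 1 / (2 * p) - 1" using that by (intro ln_le_minus_one) simp
    then have "p * (- ln 2 - ln p) \<le> p * (1 / (2 * p) - 1)"
      using that by (intro mult_left_mono) (auto simp: ln_div ln_mult)
    also have "\<dots> = 1 / 2 - p" using that by (simp add: field_simps)
    finally show ?thesis by (simp add: algebra_simps)
  qed
  have "- (ln 2) \<le> p * ln p + (1 - p) * ln (1 - p)"
    using *[of p] *[of "1 - p"] assms by (simp add: algebra_simps)
  then have "- (ln 2) / ln 2 \<le> (p * ln p + (1 - p) * ln (1 - p)) / ln 2"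
    by (intro divide_right_mono) auto
  then show ?thesis by (simp add: plogp_def log_def add_divide_distrib)
qed

lemma spow_antimono:
  assumes "0 \<le> y" "y \<le> 1" "e1 \<le> e2" shows "spow y e2 \<le> spow y e1"
  using assms powr_mono'[of e1 e2 y] by (cases "y = 0") (auto simp: spow_def)

lemma spow_strict_antimono:
  assumes "0 < y" "y < 1" shows "spow y e2 < spow y e1 \<longleftrightarrow> e1 < e2"
  using assms powr_less_mono'[of y e1 e2] powr_mono'[of e2 e1 y]
  by (auto simp: spow_def not_less[symmetric])

lemma HS_limit_le:
  assumes "n \<ge> 0" "0 \<le> x" "0 < p" "p < 1" shows "HS_limit n x p \<le> HS_limit n x (1 / 2)"
proof -
  have h: "plogp (1 / 2) + plogp (1 / 2) = - 1" by (simp add: plogp_def log_divide)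
  have "n * (hdiag (tanh (x/2)) + (plogp (1/2) + plogp (1/2))) \<le>
      n * (hdiag (tanh (x/2)) + (plogp p + plogp (1 - p)))"
    using binary_entropy_le[OF assms(3,4)] assms(1) unfolding h by (intro mult_left_mono) auto
  then show ?thesis unfolding HS_limit_eq
    by (intro spow_antimono) (use assms in \<open>auto simp: add.assoc tanh_real_lt_1 less_imp_le\<close>)
qed

lemma HS_limit_minus: "HS_limit n (- x) p = - HS_limit n x p"
  by (simp add: HS_limit_eq spow_minus hdiag_minus)

text \<open>Binary entropy is largest at 1/2, so the exponent is smallest there: a maximum for x
  \<ge> 0 and, since the limit function is odd in x, a minimum for x < 0.\<close>

lemma local_extremum_HS_limit:
  assumes "n \<ge> 0" "\<And>w. 0 < f w \<and> f w < 1" "f w0 = 1 / 2"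
  shows "local_extremum (\<lambda>w. HS_limit n x (f w)) w0"
proof (cases "x \<ge> 0")
  case True
  then show ?thesis
    unfolding local_extremum_def local_max_def assms(3) using HS_limit_le[of n x] assms(1,2)
    by (intro disjI1 always_eventually) auto
next
  case False
  then show ?thesis
    unfolding local_extremum_def local_min_def assms(3) using HS_limit_le[of n "- x"] assms(1,2)
    by (intro disjI2 always_eventually) (auto simp: HS_limit_minus)
qed

text \<open>At p = 1/2 the entropy is 1, below that of the diagonal table, so the exponent exceeds 1
  and shrinks a base strictly between 0 and 1.\<close>

lemma HS_limit_half_less:
  assumes "n > 0" "x > 0" shows "HS_limit n x (1 / 2) < tanh (x / 2)"
proof -
  have h: "plogp (1 / 2) = - 1 / 2" by (simp add: plogp_def log_divide)
  have "0 < n * (hdiag (tanh (x/2)) - 1)" using hdiag_tanh_gt[of x] assms by simp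
  then have "spow (tanh (x / 2)) (exp (n * (hdiag (tanh (x/2)) - 1))) < spow (tanh (x / 2)) 1"
    by (subst spow_strict_antimono) (use assms in \<open>auto simp: tanh_real_lt_1\<close>)
  then show ?thesis by (simp add: HS_limit_eq h)
qed

lemma HS_of_two_entries:
  assumes "entropy2 t = - (plogp p + plogp (1 - p))"
  shows "HS_of n (tanh (x / 2)) t = HS_limit n x p"
  unfolding HS_of_def HS_limit_eq assms by (simp add: algebra_simps)

text \<open>On a face of the cube two entries survive, sharing a factor c. Both orders of the sum
  are listed because either survivor may come first in \<open>cube_den\<close>.\<close>

lemma normalize_pair:
  assumes "0 < A" "0 < B" "0 < c" "p = B / (A + B :: real)"
  shows "A * c / (A * c + B * c) = 1 - p" "B * c / (A * c + B * c) = p"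
    "A * c / (B * c + A * c) = 1 - p" "B * c / (B * c + A * c) = p"
proof -
  have "A * c + B * c = (A + B) * c" "B * c + A * c = (A + B) * c" by (simp_all add: algebra_simps)
  then show "A * c / (A * c + B * c) = 1 - p" "B * c / (A * c + B * c) = p"
    "A * c / (B * c + A * c) = 1 - p" "B * c / (B * c + A * c) = p"
    unfolding assms(4) using assms(1-3) by (simp_all only:) (simp_all add: diff_divide_eq_iff)
qed

lemma inverse_exp_add:
  "inverse (1 + exp (x + z)) = 1 / (exp x * exp z + 1)"
  "inverse (1 + exp (x - z)) = exp z / (exp x + exp z)" for x z :: real
  using exp_add_1_pos[of "x - z"]
  by (simp_all add: exp_add exp_diff field_simps add_pos_pos)

lemma logistic_products:
  fixes x z :: real
  defines "c \<equiv> 1 / ((1 + exp x) * (1 + exp z))"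
  shows "logistic x * logistic z = (exp x * exp z) * c" "(1 - logistic x) * (1 - logistic z) = 1 * c"
    "(1 - logistic x) * logistic z = exp z * c" "logistic x * (1 - logistic z) = exp x * c" "0 < c"
proof -
  show "0 < c" unfolding c_def using exp_add_1_pos(1)[of x] exp_add_1_pos(1)[of z] by simp
qed (unfold one_minus_logistic, simp_all add: logistic_def c_def)

text \<open>Setting u to 1 or 0 kills the second or first row, setting w to 1 or 0 the second or
  first column. What remains is a normalized pair, whose proportion p is read off from
  \<open>inverse_exp_add\<close>.\<close>

lemma cube_HS_faces:
  "cube_HS n (logistic x, 1, logistic z) = HS_limit n x (inverse (1 + exp (x + z)))" (is ?A)
  "cube_HS n (logistic x, 0, logistic z) = HS_limit n x (inverse (1 + exp (x - z)))" (is ?B)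
  "cube_HS n (logistic x, logistic z, 1) = HS_limit n x (inverse (1 + exp (x + z)))" (is ?C)
  "cube_HS n (logistic x, logistic z, 0) = HS_limit n x (inverse (1 + exp (x - z)))" (is ?D)
proof -
  define c where "c = 1 / ((1 + exp x) * (1 + exp z))"
  note s = logistic_products[of x z, folded c_def]
  have p: "0 < exp x * exp z" "0 < (1::real)" "0 < exp x" "0 < exp z" by auto
  note n1 = normalize_pair[OF p(1,2) s(5) inverse_exp_add(1)]
  note n2 = normalize_pair[OF p(3,4) s(5) inverse_exp_add(2)]
  show ?A ?B ?C ?D
    unfolding cube_HS_def case_prod_conv tanh_half_eq[symmetric]
    by (rule HS_of_two_entries;
        simp add: entropy2_eq cube_table_def cube_den_def s n1[simplified] n2)+
qed

lemma margin_weight_uniform_limits: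
  assumes "n \<ge> 0"
  shows "uniform_limit UNIV (\<lambda>y z. margin_weight (HS n) x (y, z))
          (\<lambda>z. HS_limit n x (inverse (1 + exp (x + z)))) at_top" (is ?A)
    "uniform_limit UNIV (\<lambda>y z. margin_weight (HS n) x (y, z))
          (\<lambda>z. HS_limit n x (inverse (1 + exp (x - z)))) at_bot" (is ?B)
    "uniform_limit UNIV (\<lambda>z y. margin_weight (HS n) x (y, z))
          (\<lambda>y. HS_limit n x (inverse (1 + exp (x + y)))) at_top" (is ?C)
    "uniform_limit UNIV (\<lambda>z y. margin_weight (HS n) x (y, z))
          (\<lambda>y. HS_limit n x (inverse (1 + exp (x - y)))) at_bot" (is ?D)
proof -
  have K1: "continuous_on ({0..1} \<times> {0..1}) (\<lambda>p. cube_HS n (logistic x, fst p, snd p))"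
    by (intro continuous_on_compose2[OF continuous_on_cube_HS[OF assms]] continuous_intros)
       (use logistic_in in auto)
  have K2: "continuous_on ({0..1} \<times> {0..1}) (\<lambda>p. cube_HS n (logistic x, snd p, fst p))"
    by (intro continuous_on_compose2[OF continuous_on_cube_HS[OF assms]] continuous_intros)
       (use logistic_in in auto)
  have lg: "0 \<le> logistic y" "logistic y \<le> 1" for y using logistic_bounds[of y] by simp_all
  show ?A ?B ?C ?D
    unfolding margin_weight_def HS_Psi_cube fst_conv snd_conv
    using uniform_limit_compact_square[OF K1 logistic_at_top, of logistic]
      uniform_limit_compact_square[OF K1 logistic_at_bot, of logistic]
      uniform_limit_compact_square[OF K2 logistic_at_top, of logistic]
      uniform_limit_compact_square[OF K2 logistic_at_bot, of logistic]
    by (simp_all add: lg cube_HS_faces)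
qed

lemma inverse_exp_add_half: "inverse (1 + exp w) = 1 / 2 \<longleftrightarrow> w = (0::real)"
proof -
  have "1 / 2 = inverse (2::real)" by simp
  then show ?thesis by (simp only: inverse_eq_iff_eq) simp
qed

lemma inverse_exp_add_bounds: "0 < inverse (1 + exp w) \<and> inverse (1 + exp w) < (1::real)"
  using exp_add_1_pos(1)[of w] by (simp add: field_simps)

text \<open>Swapping the columns inverts the odds-ratio. The unnormalized entries of the two tables
  differ by the common factor exp (x - z), which normalization removes.\<close>

lemma Psi_minus:
  "Psi (- x, y, z) $ 0 $ 0 = Psi (x, y, - z) $ 0 $ 1"
  "Psi (- x, y, z) $ 0 $ 1 = Psi (x, y, - z) $ 0 $ 0"
  "Psi (- x, y, z) $ 1 $ 0 = Psi (x, y, - z) $ 1 $ 1"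
  "Psi (- x, y, z) $ 1 $ 1 = Psi (x, y, - z) $ 1 $ 0"
proof -
  define N1 where "N1 = exp (- x + y + z) + exp (- x) + exp y + exp z"
  define N2 where "N2 = exp (x + y + - z) + exp x + exp y + exp (- z)"
  have N: "N1 > 0" "N2 > 0"
    using Psi_nth(5)[of "-x" y z] Psi_nth(5)[of "x" y "-z"] by (simp_all add: N1_def N2_def)
  define c where "c = exp (x - z)"
  have N12: "N2 = c * N1" unfolding N1_def N2_def c_def by (simp add: distrib_left flip: exp_add)
  have e: "exp (x + y + - z) = c * exp y" "exp y = c * exp (- x + y + z)"
     "exp (- z) = c * exp (- x)" "exp x = c * exp z" and c: "c > 0"
    unfolding c_def by (simp_all flip: exp_add)
  have "E / N1 = (c * E) / N2" for E using c N by (simp add: N12)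
  then show "Psi (- x, y, z) $ 0 $ 0 = Psi (x, y, - z) $ 0 $ 1"
    "Psi (- x, y, z) $ 0 $ 1 = Psi (x, y, - z) $ 0 $ 0"
    "Psi (- x, y, z) $ 1 $ 0 = Psi (x, y, - z) $ 1 $ 1"
    "Psi (- x, y, z) $ 1 $ 1 = Psi (x, y, - z) $ 1 $ 0"
    unfolding Psi_nth N1_def[symmetric] N2_def[symmetric] by (metis e)+
qed

lemma HS_Psi_minus: "HS n (Psi (- x, y, z)) = - HS n (Psi (x, y, - z))"
proof -
  have "entropy2 (Psi (- x, y, z)) = entropy2 (Psi (x, y, - z))"
    by (simp add: entropy2_eq Psi_minus)
  then show ?thesis
    unfolding HS_Psi by (simp add: HS_of_def spow_minus hdiag_minus)
qed

lemma margin_weight_minus: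
  "margin_weight (HS n) (- x) v = - margin_weight (HS n) x (fst v, - snd v)"
  by (cases v) (simp add: margin_weight_def HS_Psi_minus)

text \<open>The bound c is the midpoint between Y and the largest value of the limit functions. A
  fixed gap below Y, rather than a pointwise strict inequality, is needed both for the upper limit
  in (d) and for the existence of a maximum.\<close>

lemma eventually_margin_weight_le:
  assumes "n > 0" "x > 0"
  obtains c where "c < tanh (x / 2)" "\<forall>\<^sub>F v in at_infinity. margin_weight (HS n) x v \<le> c"
proof -
  define c where "c = (HS_limit n x (1 / 2) + tanh (x / 2)) / 2"
  define e where "e = (tanh (x / 2) - HS_limit n x (1 / 2)) / 2"
  have less: "HS_limit n x (1 / 2) < tanh (x / 2)" by (rule HS_limit_half_less[OF assms])
  then have "e > 0" "c < tanh (x / 2)" by (simp_all add: e_def c_def)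
  have bound: "a \<le> c" if "dist a (HS_limit n x (inverse (1 + exp w))) < e" for a w
  proof -
    have "HS_limit n x (inverse (1 + exp w)) \<le> HS_limit n x (1 / 2)"
      using assms inverse_exp_add_bounds[of w] by (intro HS_limit_le) auto
    moreover have "c = HS_limit n x (1 / 2) + e" by (simp add: c_def e_def field_simps)
    ultimately show ?thesis using that by (simp add: dist_real_def abs_real_def split: if_splits)
  qed
  note lims = margin_weight_uniform_limits[OF less_imp_le[OF assms(1)], of x]
  have "\<forall>\<^sub>F y in at_top. \<forall>z. margin_weight (HS n) x (y, z) \<le> c"
    using uniform_limitD[OF lims(1) \<open>e > 0\<close>]
    by (rule eventually_mono) (intro allI bound, erule bspec, rule UNIV_I)
  then obtain M1 where M1: "\<And>y z. M1 \<le> y \<Longrightarrow> margin_weight (HS n) x (y, z) \<le> c"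
    unfolding eventually_at_top_linorder by blast
  have "\<forall>\<^sub>F y in at_bot. \<forall>z. margin_weight (HS n) x (y, z) \<le> c"
    using uniform_limitD[OF lims(2) \<open>e > 0\<close>]
    by (rule eventually_mono) (intro allI bound, erule bspec, rule UNIV_I)
  then obtain M2 where M2: "\<And>y z. y \<le> M2 \<Longrightarrow> margin_weight (HS n) x (y, z) \<le> c"
    unfolding eventually_at_bot_linorder by blast
  have "\<forall>\<^sub>F y in at_top. \<forall>z. margin_weight (HS n) x (z, y) \<le> c"
    using uniform_limitD[OF lims(3) \<open>e > 0\<close>]
    by (rule eventually_mono) (intro allI bound, erule bspec, rule UNIV_I)
  then obtain M3 where M3: "\<And>y z. M3 \<le> y \<Longrightarrow> margin_weight (HS n) x (z, y) \<le> c"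
    unfolding eventually_at_top_linorder by blast
  have "\<forall>\<^sub>F y in at_bot. \<forall>z. margin_weight (HS n) x (z, y) \<le> c"
    using uniform_limitD[OF lims(4) \<open>e > 0\<close>]
    by (rule eventually_mono) (intro allI bound, erule bspec, rule UNIV_I)
  then obtain M4 where M4: "\<And>y z. y \<le> M4 \<Longrightarrow> margin_weight (HS n) x (z, y) \<le> c"
    unfolding eventually_at_bot_linorder by blast
  \<comment> \<open>If the norm is at least 2M, then one of the coordinates has modulus at least M,
    because the norm is at most their sum of moduli; M dominates all four one-sided
    thresholds.\<close>
  define M where "M = \<bar>M1\<bar> + \<bar>M2\<bar> + \<bar>M3\<bar> + \<bar>M4\<bar>"
  have "margin_weight (HS n) x v \<le> c" if "norm v \<ge> 2 * M" for v
  proof -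
    obtain y z where v: "v = (y, z)" by fastforce
    have "norm v \<le> \<bar>y\<bar> + \<bar>z\<bar>" unfolding v using norm_Pair_le[of y z] by simp
    with that consider "M \<le> y" | "y \<le> - M" | "M \<le> z" | "z \<le> - M" by linarith
    then show ?thesis unfolding v using M1[of y z] M2[of y z] M3[of z y] M4[of z y]
      by cases (auto simp: M_def)
  qed
  then have "\<forall>\<^sub>F v in at_infinity. margin_weight (HS n) x v \<le> c"
    unfolding eventually_at_infinity by blast
  with \<open>c < tanh (x / 2)\<close> show ?thesis by (rule that)
qed

lemma eventually_margin_weight_ge:
  assumes "n > 0" "x < 0"
  obtains c where "tanh (x / 2) < c" "\<forall>\<^sub>F v in at_infinity. c \<le> margin_weight (HS n) x v"
proof -
  have "- x > 0" using assms by simp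
  from eventually_margin_weight_le[OF assms(1) this] obtain c
    where c: "c < tanh (- x / 2)" and "\<forall>\<^sub>F v in at_infinity. margin_weight (HS n) (- x) v \<le> c"
    by auto
  then obtain b where b: "\<And>v. norm v \<ge> b \<Longrightarrow> margin_weight (HS n) (- x) v \<le> c"
    unfolding eventually_at_infinity by auto
  have "- c \<le> margin_weight (HS n) x v" if "norm v \<ge> b" for v
  proof -
    have "norm (fst v, - snd v) = norm v" by (simp add: norm_prod_def)
    then show ?thesis using b[of "(fst v, - snd v)"] that by (simp add: margin_weight_minus)
  qed
  then show ?thesis using that[of "- c"] c unfolding eventually_at_infinity by auto
qed

lemma HS_downweights_margins:
  assumes "n > 0"
  shows "x > 0 \<Longrightarrow> Limsup at_infinity (\<lambda>v. ereal (margin_weight (HS n) x v)) < ereal (margin_weight Yule_Y x u)"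
    "x < 0 \<Longrightarrow> Liminf at_infinity (\<lambda>v. ereal (margin_weight (HS n) x v)) > ereal (margin_weight Yule_Y x u)"
proof -
  have Y: "margin_weight Yule_Y x u = tanh (x / 2)" by (cases u) (simp add: margin_weight_def Yule_Y_Psi)
  assume "x > 0"
  then obtain c where c: "c < tanh (x / 2)" "\<forall>\<^sub>F v in at_infinity. margin_weight (HS n) x v \<le> c"
    using eventually_margin_weight_le assms by blast
  then have "Limsup at_infinity (\<lambda>v. ereal (margin_weight (HS n) x v)) \<le> ereal c"
    by (intro Limsup_bounded) auto
  also have "\<dots> < ereal (margin_weight Yule_Y x u)" using c Y by simp
  finally show "Limsup at_infinity (\<lambda>v. ereal (margin_weight (HS n) x v)) < ereal (margin_weight Yule_Y x u)" .
next
  have Y: "margin_weight Yule_Y x u = tanh (x / 2)" by (cases u) (simp add: margin_weight_def Yule_Y_Psi)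
  assume "x < 0"
  then obtain c where c: "tanh (x / 2) < c" "\<forall>\<^sub>F v in at_infinity. c \<le> margin_weight (HS n) x v"
    using eventually_margin_weight_ge assms by blast
  then have "ereal c \<le> Liminf at_infinity (\<lambda>v. ereal (margin_weight (HS n) x v))"
    by (intro Liminf_bounded) auto
  moreover have "ereal (margin_weight Yule_Y x u) < ereal c" using c Y by simp
  ultimately show "Liminf at_infinity (\<lambda>v. ereal (margin_weight (HS n) x v)) > ereal (margin_weight Yule_Y x u)"
    by order
qed

section \<open>Limits for x tending to plus or minus infinity\<close>

lemma tables_le_1:
  assumes "t \<in> tables" shows "0 \<le> t $ i $ j" "t $ i $ j \<le> 1"
proof -
  have "\<forall>i j. 0 \<le> t $ i $ j \<and> t $ i $ j \<le> 1" using assms by (auto simp: all_2_iff tables_iff)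
  then show "0 \<le> t $ i $ j" "t $ i $ j \<le> 1" by auto
qed

text \<open>For x \<ge> 0 the function lies between tanh (x/2) to the power exp (8n) and 1, and
  neither bound depends on the margins. The column swap yields the other end.\<close>

lemma margin_weight_uniform_limit_x:
  assumes "n \<ge> 0"
  shows "uniform_limit UNIV (\<lambda>x v. margin_weight (HS n) x v) (\<lambda>_. 1) at_top"
    "uniform_limit UNIV (\<lambda>x v. margin_weight (HS n) x v) (\<lambda>_. - 1) at_bot"
proof -
  have "((\<lambda>x. 2 * logistic x - 1) \<longlongrightarrow> 2 * 1 - 1) at_top" by (intro tendsto_intros logistic_at_top)
  then have "((\<lambda>x. tanh (x / 2) powr exp (8 * n)) \<longlongrightarrow> 1 powr exp (8 * n)) at_top"
    by (intro tendsto_powr tendsto_const) (auto simp: tanh_half_eq)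
  then have lim: "((\<lambda>x. tanh (x / 2) powr exp (8 * n)) \<longlongrightarrow> 1) at_top" by simp
  have bound: "tanh (x / 2) powr exp (8 * n) \<le> margin_weight (HS n) x v"
    "margin_weight (HS n) x v \<le> 1" if "x \<ge> 0" for x v
  proof -
    obtain y z where v: "v = (y, z)" by fastforce
    have "0 \<le> tanh (x / 2)" "tanh (x / 2) \<le> 1"
      using that by (simp_all add: tanh_real_lt_1 less_imp_le)
    note HS_of_bounds[OF assms this tables_le_1[OF Psi_in_tables]]
    then show "tanh (x / 2) powr exp (8 * n) \<le> margin_weight (HS n) x v"
      "margin_weight (HS n) x v \<le> 1"
      unfolding margin_weight_def v HS_Psi fst_conv snd_conv by blast+
  qed
  have "\<forall>\<^sub>F x in at_top. \<forall>v. \<bar>margin_weight (HS n) x v - 1\<bar> < e" if "e > 0" for e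
  proof -
    have "\<forall>\<^sub>F x in at_top. tanh (x / 2) powr exp (8 * n) > 1 - e"
      using order_tendstoD(1)[OF lim] that by simp
    with eventually_ge_at_top[of 0] show ?thesis
    proof eventually_elim
      case (elim x)
      show ?case
      proof
        fix v
        show "\<bar>margin_weight (HS n) x v - 1\<bar> < e" using bound[OF elim(1), of v] elim(2) by linarith
      qed
    qed
  qed
  note ev = this
  show "uniform_limit UNIV (\<lambda>x v. margin_weight (HS n) x v) (\<lambda>_. 1) at_top"
    using ev by (intro uniform_limitI) (auto simp: dist_real_def)
  show "uniform_limit UNIV (\<lambda>x v. margin_weight (HS n) x v) (\<lambda>_. - 1) at_bot"
  proof (rule uniform_limitI)
    fix e :: real assume "e > 0"
    have "\<bar>margin_weight (HS n) (- x) v + 1\<bar> = \<bar>margin_weight (HS n) x (fst v, - snd v) - 1\<bar>" for x v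
      by (simp add: margin_weight_minus)
    then show "\<forall>\<^sub>F x in at_bot. \<forall>v\<in>UNIV. dist (margin_weight (HS n) x v) (- 1) < e"
      unfolding at_bot_mirror eventually_filtermap using ev[OF \<open>e > 0\<close>]
      by (auto simp: dist_real_def elim!: eventually_mono)
  qed
qed

subsection \<open>Extension to the closure of the tables\<close>

text \<open>Y with its fraction expanded by the root of p01 p10, so that single zero entries are
  harmless. The denominator vanishes only if both p00 p11 and p01 p10 do, which forces a zero row or
  column.\<close>

definition Yule_Y_ext :: "table \<Rightarrow> real" where
  "Yule_Y_ext t = (sqrt (t$0$0 * t$1$1) - sqrt (t$0$1 * t$1$0)) /
     (sqrt (t$0$0 * t$1$1) + sqrt (t$0$1 * t$1$0))"

lemma Yule_Y_eq_ext:
  assumes "t \<in> tables" shows "Yule_Y t = Yule_Y_ext t"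
proof -
  define A B where "A = sqrt (t$0$0 * t$1$1)" "B = sqrt (t$0$1 * t$1$0)"
  have "A > 0" "B > 0" using assms by (auto simp: A_B_def tables_iff)
  have "sqrt (odds_ratio t) = A / B"
    by (simp add: odds_ratio_def A_B_def real_sqrt_divide)
  then have "Yule_Y t = (A / B - 1) / (A / B + 1)" by (simp add: Yule_Y_def)
  also have "A / B - 1 = (A - B) / B" using \<open>B > 0\<close> by (simp add: field_simps)
  also have "A / B + 1 = (A + B) / B" using \<open>B > 0\<close> by (simp add: field_simps)
  also have "(A - B) / B / ((A + B) / B) = (A - B) / (A + B)" using \<open>B > 0\<close> by simp
  finally show ?thesis by (simp add: Yule_Y_ext_def A_B_def)
qed

lemma diff_div_add_bounds:
  fixes A B :: real assumes "0 \<le> A" "0 \<le> B"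
  shows "- 1 \<le> (A - B) / (A + B)" "(A - B) / (A + B) \<le> 1"
  using assms by (cases "A + B = 0"; simp add: field_simps)+

lemma HS_extends_closure:
  "\<exists>G :: table \<Rightarrow> real. continuous_on (closure tables - Collect zero_row_or_column) G \<and>
          (\<forall>t\<in>tables. G t = HS n t)"
proof (intro exI conjI ballI)
  let ?S = "closure tables - Collect zero_row_or_column"
  have "sqrt (t$0$0 * t$1$1) + sqrt (t$0$1 * t$1$0) \<noteq> 0" if "t \<in> ?S" for t
  proof
    assume "sqrt (t$0$0 * t$1$1) + sqrt (t$0$1 * t$1$0) = 0"
    moreover have "0 \<le> t$i$j" for i j using that closure_tables by blast
    ultimately have "t$0$0 * t$1$1 = 0 \<and> t$0$1 * t$1$0 = 0"
      by (metis add_nonneg_eq_0_iff mult_nonneg_nonneg real_sqrt_eq_0_iff real_sqrt_ge_zero)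
    then have "zero_row_or_column t"
      by (auto simp: zero_row_or_column_def all_2_iff ex_2_iff)
    with that show False by blast
  qed
  then have "continuous_on ?S Yule_Y_ext"
    unfolding Yule_Y_ext_def[abs_def] by (intro continuous_intros) auto
  moreover have "- 1 \<le> Yule_Y_ext t \<and> Yule_Y_ext t \<le> 1" if "t \<in> ?S" for t
    unfolding Yule_Y_ext_def using that closure_tables[of t]
    by (intro conjI diff_div_add_bounds) auto
  ultimately show "continuous_on ?S (\<lambda>t. HS_of n (Yule_Y_ext t) t)"
    using closure_tables by (intro continuous_on_HS_of continuous_intros) auto
next
  fix t assume "t \<in> tables"
  then show "HS_of n (Yule_Y_ext t) t = HS n t"
    using odds_ratio_pos[of t] by (simp add: HS_eq Yule_Y_eq_ext less_imp_le)
qed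

text \<open>A table with a vanishing row or column is the product of its margins \<open>\<alpha>\<close>, \<open>\<beta>\<close>. It is
  approached by products of perturbed margins, where the odds ratio is \<open>1\<close>. Shifting these by
  \<open>\<delta> = min (\<alpha>\<^sub>0 \<beta>\<^sub>1) (\<alpha>\<^sub>1 \<beta>\<^sub>0) / 2\<close>, which tends to \<open>0\<close>, makes the odds ratio at least \<open>2\<close>.\<close>

definition shifted_product :: "real \<Rightarrow> real \<Rightarrow> real \<Rightarrow> table" where
  "shifted_product a b \<delta> = mk_table (a * b + \<delta>) (a * (1 - b) - \<delta>) ((1 - a) * b - \<delta>) ((1 - a) * (1 - b) + \<delta>)"

lemma shifted_product_in_tables:
  assumes "0 < a" "a < 1" "0 < b" "b < 1" "0 \<le> \<delta>" "\<delta> < a * (1 - b)" "\<delta> < (1 - a) * b"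
  shows "shifted_product a b \<delta> \<in> tables"
proof -
  have "0 < a * b + \<delta>" "0 < (1 - a) * (1 - b) + \<delta>" using assms by (auto intro!: add_pos_nonneg)
  moreover have "(a * b + \<delta>) + (a * (1 - b) - \<delta>) + ((1 - a) * b - \<delta>) + ((1 - a) * (1 - b) + \<delta>) = 1"
    by (simp add: algebra_simps)
  ultimately show ?thesis using assms by (simp add: tables_iff shifted_product_def)
qed

lemma odds_ratio_shifted_product_0:
  assumes "0 < a" "a < 1" "0 < b" "b < 1"
  shows "odds_ratio (shifted_product a b 0) = 1"
  using assms by (simp add: odds_ratio_def shifted_product_def)

text \<open>For the unshifted product both diagonals have the product P Q. The shift halves the
  smaller antidiagonal entry and decreases the other, while both entries of the main diagonal
  grow.\<close>

lemma odds_ratio_shifted_product_ge: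
  assumes "0 < a" "a < 1" "0 < b" "b < 1" "\<delta> = min (a * (1 - b)) ((1 - a) * b) / 2"
  shows "2 \<le> odds_ratio (shifted_product a b \<delta>)"
proof -
  define P Q where "P = a * (1 - b)" "Q = (1 - a) * b"
  have PQ: "0 < P" "0 < Q" using assms by (simp_all add: P_Q_def)
  have d: "\<delta> = min P Q / 2" using assms by (simp add: P_Q_def)
  then have d0: "0 \<le> \<delta>" "\<delta> < P" "\<delta> < Q" using PQ by auto
  have "2 * ((P - \<delta>) * (Q - \<delta>)) \<le> P * Q"
  proof (cases "P \<le> Q")
    case True
    then have "2 * (P - \<delta>) = P" using d by simp
    then have "2 * ((P - \<delta>) * (Q - \<delta>)) = P * (Q - \<delta>)" by (metis mult.assoc)
    then show ?thesis using PQ d0 by (simp add: mult_left_mono)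
  next
    case False
    then have "2 * (Q - \<delta>) = Q" using d by simp
    then have "2 * ((P - \<delta>) * (Q - \<delta>)) = (P - \<delta>) * Q" by (metis mult.assoc mult.commute)
    then show ?thesis using PQ d0 by (simp add: mult_right_mono)
  qed
  also have "P * Q = (a * b) * ((1 - a) * (1 - b))" by (simp add: P_Q_def)
  also have "\<dots> \<le> (a * b + \<delta>) * ((1 - a) * (1 - b) + \<delta>)"
    using assms(1-4) d0 by (intro mult_mono) auto
  finally show ?thesis
    using d0 unfolding odds_ratio_def shifted_product_def mk_table_nth P_Q_def[symmetric]
    by (subst le_divide_eq) auto
qed

lemma tendsto_mk_table:
  assumes "(a \<longlongrightarrow> a') F" "(b \<longlongrightarrow> b') F" "(c \<longlongrightarrow> c') F" "(d \<longlongrightarrow> d') F"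
  shows "((\<lambda>x. mk_table (a x) (b x) (c x) (d x)) \<longlongrightarrow> mk_table a' b' c' d') F"
  unfolding mk_table_def
proof (intro tendsto_vec_lambda)
  fix i j :: 2
  show "((\<lambda>x. if i = 0 then if j = 0 then a x else b x else if j = 0 then c x else d x) \<longlongrightarrow>
      (if i = 0 then if j = 0 then a' else b' else if j = 0 then c' else d')) F"
    by (cases "i = 0"; cases "j = 0") (use assms in auto)
qed

text \<open>Two approaches to t disagree: along products of margins the value is 0, while along the
  shifted ones the odds-ratio is at least 2 and \<open>HS_of_bounds\<close> keeps the value above a
  positive constant.\<close>

lemma HS_no_limit:
  assumes n: "n \<ge> 0" and t: "t \<in> closure tables" "zero_row_or_column t"
  shows "\<not> (\<exists>l. (HS n \<longlongrightarrow> l) (at t within tables))"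
proof
  assume "\<exists>l. (HS n \<longlongrightarrow> l) (at t within tables)"
  then obtain l where l: "(HS n \<longlongrightarrow> l) (at t within tables)" ..
  define \<alpha> \<beta> where "\<alpha> = t$0$0 + t$0$1" "\<beta> = t$0$0 + t$1$0"
  note nn = closure_tables[OF t(1)]
  have ab: "0 \<le> \<alpha>" "\<alpha> \<le> 1" "0 \<le> \<beta>" "\<beta> \<le> 1"
    using nn(1)[of 0 0] nn(1)[of 0 1] nn(1)[of 1 0] nn(1)[of 1 1] nn(2)
    by (simp_all add: \<alpha>_\<beta>_def)
  have "\<alpha> = 0 \<or> \<alpha> = 1 \<or> \<beta> = 0 \<or> \<beta> = 1"
    using t(2) nn(2) by (auto simp: \<alpha>_\<beta>_def zero_row_or_column_def all_2_iff ex_2_iff)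
  then have z: "min (\<alpha> * (1 - \<beta>)) ((1 - \<alpha>) * \<beta>) = 0"
    using ab by (elim disjE) (simp_all add: min_def)
  have "t$0$0 * t$1$1 = t$0$1 * t$1$0"
    using t(2) by (auto simp: zero_row_or_column_def all_2_iff ex_2_iff)
  moreover have "\<alpha> * \<beta> = t$0$0 * (t$0$0 + t$0$1 + t$1$0 + t$1$1) + (t$0$1 * t$1$0 - t$0$0 * t$1$1)"
    by (simp add: \<alpha>_\<beta>_def algebra_simps)
  ultimately have "\<alpha> * \<beta> = t$0$0" unfolding nn(2) by simp
  moreover have st: "t$0$1 = \<alpha> - t$0$0" "t$1$0 = \<beta> - t$0$0" "t$1$1 = 1 - \<alpha> - \<beta> + t$0$0"
    using nn(2) by (simp_all add: \<alpha>_\<beta>_def)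
  ultimately have "\<alpha> * \<beta> + 0 = t$0$0" "\<alpha> * (1 - \<beta>) - 0 = t$0$1" "(1 - \<alpha>) * \<beta> - 0 = t$1$0"
    "(1 - \<alpha>) * (1 - \<beta>) + 0 = t$1$1"
    using st by (simp_all add: right_diff_distrib left_diff_distrib)
  then have t_eq: "shifted_product \<alpha> \<beta> 0 = t"
    unfolding shifted_product_def by (simp only: mk_table_eta)
  \<comment> \<open>The filter at t is punctured; t lying outside \<open>tables\<close> ensures that
    the approaching tables differ from t.\<close>
  have "\<not> (\<forall>i j. 0 < t$i$j)" using t(2) unfolding zero_row_or_column_def by (metis less_irrefl)
  then have t_notin: "t \<notin> tables" by (auto simp: tables_def)
  \<comment> \<open>Weighted means of the given margins and 1/2, with weights 1 and 2\<epsilon>: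
    this moves margins 0 and 1 into the open interval.\<close>
  define a b where "a = (\<lambda>\<epsilon>. (\<alpha> + \<epsilon>) / (1 + 2 * \<epsilon>))" "b = (\<lambda>\<epsilon>. (\<beta> + \<epsilon>) / (1 + 2 * \<epsilon>))"
  have lim: "(a \<longlongrightarrow> \<alpha>) (at_right 0)" "(b \<longlongrightarrow> \<beta>) (at_right 0)"
    unfolding a_b_def by real_asymp+
  have pos: "0 < a \<epsilon> \<and> a \<epsilon> < 1 \<and> 0 < b \<epsilon> \<and> b \<epsilon> < 1" if "\<epsilon> > 0" for \<epsilon>
  proof -
    have "0 < (q + \<epsilon>) / (1 + 2 * \<epsilon>) \<and> (q + \<epsilon>) / (1 + 2 * \<epsilon>) < 1" if "0 \<le> q" "q \<le> 1" for q
      using that \<open>\<epsilon> > 0\<close> by (simp add: pos_divide_less_eq)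
    then show ?thesis using ab unfolding a_b_def by blast
  qed
  have along: "((\<lambda>\<epsilon>. HS n (shifted_product (a \<epsilon>) (b \<epsilon>) (d \<epsilon>))) \<longlongrightarrow> l) (at_right 0)"
    if d: "(d \<longlongrightarrow> 0) (at_right 0)"
      "\<And>\<epsilon>. \<epsilon> > 0 \<Longrightarrow> 0 \<le> d \<epsilon> \<and> d \<epsilon> < a \<epsilon> * (1 - b \<epsilon>) \<and> d \<epsilon> < (1 - a \<epsilon>) * b \<epsilon>" for d
  proof (rule filterlim_compose[OF l])
    have "((\<lambda>\<epsilon>. shifted_product (a \<epsilon>) (b \<epsilon>) (d \<epsilon>)) \<longlongrightarrow> shifted_product \<alpha> \<beta> 0) (at_right 0)"
      unfolding shifted_product_def by (intro tendsto_mk_table tendsto_intros lim d)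
    moreover have "\<forall>\<^sub>F \<epsilon> in at_right 0. shifted_product (a \<epsilon>) (b \<epsilon>) (d \<epsilon>) \<in> tables"
      using eventually_at_right_less[of "0::real"]
    proof eventually_elim
      case (elim \<epsilon>)
      then show ?case
        using pos[OF elim] d(2)[OF elim] by (intro shifted_product_in_tables) auto
    qed
    ultimately show "filterlim (\<lambda>\<epsilon>. shifted_product (a \<epsilon>) (b \<epsilon>) (d \<epsilon>)) (at t within tables) (at_right 0)"
      unfolding filterlim_at t_eq using t_notin
      by (intro conjI) (erule eventually_mono, metis)
  qed
  have "((\<lambda>\<epsilon>. HS n (shifted_product (a \<epsilon>) (b \<epsilon>) 0)) \<longlongrightarrow> l) (at_right 0)"
  proof (rule along[OF tendsto_const])
    fix \<epsilon> :: real assume "\<epsilon> > 0"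
    from pos[OF this] show "0 \<le> (0::real) \<and> 0 < a \<epsilon> * (1 - b \<epsilon>) \<and> 0 < (1 - a \<epsilon>) * b \<epsilon>" by simp
  qed
  moreover have "\<forall>\<^sub>F \<epsilon> in at_right 0. HS n (shifted_product (a \<epsilon>) (b \<epsilon>) 0) = 0"
    using eventually_at_right_less[of "0::real"]
  proof eventually_elim
    case (elim \<epsilon>)
    then show ?case
      using pos[OF elim] by (simp add: HS_def Yule_Y_def odds_ratio_shifted_product_0)
  qed
  then have "((\<lambda>\<epsilon>. HS n (shifted_product (a \<epsilon>) (b \<epsilon>) 0)) \<longlongrightarrow> 0) (at_right 0)"
    by (rule tendsto_eventually)
  ultimately have "l = 0"
    by (rule tendsto_unique[OF trivial_limit_at_right_real])
  define d where "d = (\<lambda>\<epsilon>. min (a \<epsilon> * (1 - b \<epsilon>)) ((1 - a \<epsilon>) * b \<epsilon>) / 2)"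
  \<comment> \<open>The value of Y at odds-ratio 2.\<close>
  define c where "c = (sqrt 2 - 1) / (sqrt 2 + 1)"
  have "c > 0" by (simp add: c_def add_pos_pos)
  have "(d \<longlongrightarrow> min (\<alpha> * (1 - \<beta>)) ((1 - \<alpha>) * \<beta>) / 2) (at_right 0)"
    unfolding d_def by (intro tendsto_intros lim) auto
  then have d0: "(d \<longlongrightarrow> 0) (at_right 0)" unfolding z by simp
  have db: "0 \<le> d \<epsilon> \<and> d \<epsilon> < a \<epsilon> * (1 - b \<epsilon>) \<and> d \<epsilon> < (1 - a \<epsilon>) * b \<epsilon>" if "\<epsilon> > 0" for \<epsilon>
  proof -
    have "0 < a \<epsilon> * (1 - b \<epsilon>)" "0 < (1 - a \<epsilon>) * b \<epsilon>" using pos[OF that] by auto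
    moreover have "0 \<le> min P Q / 2 \<and> min P Q / 2 < P \<and> min P Q / 2 < Q"
      if "0 < P" "0 < Q" for P Q :: real using that by auto
    ultimately show ?thesis unfolding d_def by blast
  qed
  have "((\<lambda>\<epsilon>. HS n (shifted_product (a \<epsilon>) (b \<epsilon>) (d \<epsilon>))) \<longlongrightarrow> l) (at_right 0)"
    by (rule along[OF d0 db])
  moreover have "\<forall>\<^sub>F \<epsilon> in at_right 0. c powr exp (8 * n) \<le> HS n (shifted_product (a \<epsilon>) (b \<epsilon>) (d \<epsilon>))"
    using eventually_at_right_less[of "0::real"]
  proof eventually_elim
    case (elim \<epsilon>)
    define T where "T = shifted_product (a \<epsilon>) (b \<epsilon>) (d \<epsilon>)"
    have T: "T \<in> tables" unfolding T_def
      using pos[OF elim] db[OF elim] by (intro shifted_product_in_tables) auto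
    have "2 \<le> odds_ratio T" unfolding T_def
      using pos[OF elim] by (intro odds_ratio_shifted_product_ge) (auto simp: d_def)
    then have s: "sqrt 2 \<le> sqrt (odds_ratio T)" by simp
    have mono: "(s - 1) / (s + 1) \<le> (s' - 1) / (s' + 1)" if "0 \<le> s" "s \<le> s'" for s s' :: real
      using that by (simp add: field_simps)
    have cY: "c \<le> Yule_Y T"
      unfolding c_def Yule_Y_def by (rule mono[OF _ s]) simp
    then have "c powr exp (8 * n) \<le> Yule_Y T powr exp (8 * n)"
      using \<open>c > 0\<close> by (intro powr_mono2) auto
    also have "\<dots> \<le> HS n T"
      using cY \<open>c > 0\<close> odds_ratio_pos[OF T] Yule_Y_bounds[of T] tables_le_1[OF T] n
      by (subst HS_eq) (auto intro!: HS_of_bounds)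
    finally show ?case by (simp add: T_def)
  qed
  ultimately have "c powr exp (8 * n) \<le> l"
    by (rule tendsto_lowerbound[OF _ _ trivial_limit_at_right_real])
  with \<open>l = 0\<close> \<open>c > 0\<close> show False by simp
qed

text \<open>The table is its own diagonal table, so the exponent is exp 0 = 1 and Y remains. All
  margins are 1/2, so D' and r both divide D = (a - b)/2 by 1/4, and Y is also 2(a - b).\<close>

lemma measures_at_diagonal_tables:
  assumes t: "t \<in> tables" "diagonal_table t"
  shows "HS n t = Yule_Y t" "HS n t = D_prime t" "HS n t = corr_r t"
proof -
  define a b where "a = t$0$0" "b = t$0$1"
  have e: "t$0$0 = a" "t$0$1 = b" "t$1$0 = b" "t$1$1 = a" "0 < a" "0 < b" "b = 1 / 2 - a"
    using t by (auto simp: tables_iff diagonal_table_def a_b_def)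
  have "odds_ratio t = (a / b)\<^sup>2" by (simp add: odds_ratio_def e(1-4) power2_eq_square)
  then have s: "sqrt (odds_ratio t) = a / b" using e(5,6) by simp
  have "a + b = 1 / 2" using e by simp
  have p: "1 / (2 * (1 + a / b)) * (a / b) = a" "1 / (2 * (1 + a / b)) = b"
  proof -
    have "2 * (1 + a / b) = 1 / b" using e(5,6) \<open>a + b = 1 / 2\<close> by (simp add: field_simps)
    then show "1 / (2 * (1 + a / b)) * (a / b) = a" "1 / (2 * (1 + a / b)) = b"
      using e(6) by simp_all
  qed
  have "(1 / (2 * (1 + a / b))) *\<^sub>R mk_table (a / b) 1 1 (a / b) = t"
    unfolding scaleR_mk_table p(1) mult_1_right unfolding p(2)
    using mk_table_eta[of t] by (simp only: e(1-4))
  then have "entropy_diag t = entropy2 t" unfolding entropy_diag_def s Let_def by simp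
  then show HY: "HS n t = Yule_Y t" using spow_1_right[of "Yule_Y t"] by (simp add: HS_def spow_def)
  have "a / b + 1 = 1 / (2 * b)" using e(6) \<open>a + b = 1 / 2\<close> by (simp add: field_simps)
  then have "Yule_Y t = (a / b - 1) * (2 * b)" unfolding Yule_Y_def s by simp
  also have "\<dots> = 2 * (a - b)" using e(6) by (simp add: field_simps)
  finally have Y: "Yule_Y t = 2 * (a - b)" .
  have D: "D_coeff t = (a - b) / 2"
    unfolding D_coeff_def e(1-4) e(7) by (simp add: field_simps power2_eq_square)
  have rc: "row_sum t 0 = 1 / 2" "row_sum t 1 = 1 / 2" "col_sum t 0 = 1 / 2" "col_sum t 1 = 1 / 2"
    using e(7) by (simp_all add: row_sum_def col_sum_def sum_UNIV_2 e(1-4))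
  have "D_max t = 1 / 4" by (simp add: D_max_def rc)
  then show "HS n t = D_prime t" by (simp only: HY Y D_prime_def D) simp
  have "sqrt (1 / 2 * (1 / 2) * (1 / 2) * (1 / 2)) = 1 / (4::real)"
    by (rule real_sqrt_unique) (auto simp: power2_eq_square)
  then show "HS n t = corr_r t" by (simp only: HY Y corr_r_def D rc) simp
qed

subsection \<open>Critical points of the entropy\<close>

lemma less_sinh: "y < sinh y" if "y > 0" for y :: real
proof -
  have "sinh 0 - 0 < sinh y - y"
  proof (rule DERIV_pos_imp_increasing_open[OF that])
    fix t :: real assume t: "0 < t" "t < y"
    have "((\<lambda>t. sinh t - t) has_real_derivative cosh t - 1) (at t)"
      by (auto intro!: derivative_eq_intros)
    moreover have "cosh t - 1 > 0" using t cosh_real_nonneg_less_iff[of 0 t] by simp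
    ultimately show "\<exists>d. ((\<lambda>t. sinh t - t) has_real_derivative d) (at t) \<and> 0 < d" by blast
  qed (intro continuous_intros)
  then show ?thesis by simp
qed

lemma sinh_less_mult_cosh: "sinh y < y * cosh y" if "y > 0" for y :: real
proof -
  have "0 * cosh 0 - sinh 0 < y * cosh y - sinh y"
  proof (rule DERIV_pos_imp_increasing_open[OF that])
    fix t :: real assume t: "0 < t" "t < y"
    have "((\<lambda>t. t * cosh t - sinh t) has_real_derivative t * sinh t) (at t)"
      by (auto intro!: derivative_eq_intros)
    moreover have "t * sinh t > 0" using t by simp
    ultimately show "\<exists>d. ((\<lambda>t. t * cosh t - sinh t) has_real_derivative d) (at t) \<and> 0 < d" by blast
  qed (intro continuous_intros)
  then show ?thesis by simp
qed

text \<open>This is \<open>sinh_less_mult_cosh\<close> at the half argument h = y/2, multiplied by 4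
  cosh h and rewritten by the double-angle formulas.\<close>

lemma two_sinh_less: "2 * sinh y < y * (cosh y + 1)" if "y > 0" for y :: real
proof -
  define h where "h = y / 2"
  have h: "h > 0" "y = 2 * h" using that by (simp_all add: h_def)
  have "sinh h * (4 * cosh h) < h * cosh h * (4 * cosh h)"
    using sinh_less_mult_cosh[OF h(1)] by (intro mult_strict_right_mono) auto
  moreover have "cosh (2 * h) + 1 = 2 * (cosh h * cosh h)"
    unfolding cosh_double using hyperbolic_pythagoras[of h] by (simp add: power2_eq_square)
  ultimately show ?thesis
    unfolding h(2) sinh_double by (simp add: ac_simps)
qed

text \<open>Up to a positive factor, the derivative of the entropy along the line z = - y.\<close>

definition antidiag_slope :: "real \<Rightarrow> real \<Rightarrow> real" where
  "antidiag_slope x y = exp x * (x * sinh y - y * cosh y) - y"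

lemma antidiag_slope_minus: "antidiag_slope x (- y) = - antidiag_slope x y"
  by (simp add: antidiag_slope_def algebra_simps)

text \<open>The hypothesis says x e^x < e^x + 1, which bounds the slope by (S - y) - e^x (y C - S).
  As e^x \<ge> 1 and y C > S, this is at most 2 S - y (C + 1), negative by
  \<open>two_sinh_less\<close>.\<close>

lemma antidiag_slope_neg_below_threshold:
  assumes "x > 0" "(x - 1) * exp x < 1" "y > 0"
  shows "antidiag_slope x y < 0"
proof -
  define X S C where "X = exp x" "S = sinh y" "C = cosh y"
  have X: "X \<ge> 1" "X * x < X + 1" using assms by (simp_all add: X_S_C_def algebra_simps)
  have S: "S > y" "2 * S < y * (C + 1)"
    using less_sinh[OF assms(3)] two_sinh_less[OF assms(3)] by (simp_all add: X_S_C_def)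
  have "(X * x) * S < (X + 1) * S" using X S assms(3) by (intro mult_strict_right_mono) auto
  moreover have "1 * (y * C - S) \<le> X * (y * C - S)"
    using X S by (intro mult_right_mono) (auto simp: algebra_simps)
  ultimately show ?thesis using S unfolding antidiag_slope_def X_S_C_def[symmetric] by (simp add: algebra_simps)
qed

text \<open>The slope vanishes at 0, with derivative e^x (x - 1) - 1 there; this expression is the
  origin of the threshold.\<close>

lemma antidiag_slope_pos_above_threshold:
  assumes "(x - 1) * exp x > 1"
  obtains d where "d > 0" "\<And>y. 0 < y \<Longrightarrow> y < d \<Longrightarrow> 0 < antidiag_slope x y"
proof -
  have "(antidiag_slope x has_real_derivative (exp x * (x - 1) - 1)) (at 0)"
    unfolding antidiag_slope_def[abs_def] by (auto intro!: derivative_eq_intros)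
  moreover have "exp x * (x - 1) - 1 > 0" using assms by (simp add: mult.commute)
  ultimately obtain d where "d > 0" "\<forall>h>0. h < d \<longrightarrow> antidiag_slope x 0 < antidiag_slope x (0 + h)"
    using DERIV_pos_inc_right by blast
  moreover have "antidiag_slope x 0 = 0" by (simp add: antidiag_slope_def)
  ultimately show ?thesis using that by simp
qed

text \<open>Positive zeros of \<open>antidiag_slope x\<close> are points where the increasing function
  \<open>y \<mapsto> (e\<^sup>x y cosh y + y) / sinh y\<close> takes the value \<open>x e\<^sup>x\<close>.\<close>

lemma antidiag_slope_root_unique_aux:
  assumes "x > 0" "0 < y1" "y1 < y2" "antidiag_slope x y1 = 0" "antidiag_slope x y2 = 0"
  shows False
proof -
  define X where "X = exp x"
  have X: "X > 1" using assms by (simp add: X_def)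
  let ?R = "\<lambda>y. (X * y * cosh y + y) / sinh y"
  have R: "?R y = X * x" if "0 < y" "antidiag_slope x y = 0" for y
    using that by (simp add: antidiag_slope_def X_def divide_eq_eq algebra_simps)
  have "?R y1 < ?R y2"
  proof (rule DERIV_pos_imp_increasing[OF assms(3)])
    fix t assume t: "y1 \<le> t" "t \<le> y2"
    then have t0: "t > 0" using assms by simp
    define S C where "S = sinh t" "C = cosh t"
    have SC: "S > 0" "S > t" "C \<ge> 1" "C * C = S * S + 1"
      using t0 less_sinh[OF t0] cosh_square_eq[of t] by (simp_all add: S_C_def cosh_real_ge_1 power2_eq_square)
    \<comment> \<open>The numerator of the derivative after replacing the squared cosh by one plus
      the squared sinh.\<close>
    define d where "d = X * (C * S - t) + S - t * C"
    have "((\<lambda>y. (X * y * cosh y + y) / sinh y) has_real_derivative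
        ((X * C + X * t * S + 1) * S - (X * t * C + t) * C) / (S * S)) (at t)"
      using SC by (auto intro!: derivative_eq_intros simp: S_C_def algebra_simps)
    also have "(X * C + X * t * S + 1) * S - (X * t * C + t) * C = X * (C * S) + X * t * (S * S) + S - X * t * (C * C) - t * C"
      by (simp add: algebra_simps)
    also have "\<dots> = d" unfolding SC(4) d_def by (simp add: algebra_simps)
    finally have D: "((\<lambda>y. (X * y * cosh y + y) / sinh y) has_real_derivative d / (S * S)) (at t)" .
    have "1 * S \<le> C * S" using SC by (intro mult_right_mono) auto
    then have "t \<le> C * S" using SC by linarith
    \<comment> \<open>Replacing X by 1 only decreases d, and (C S - t) + (S - t C) factors as (S -
      t)(C + 1).\<close>
    then have "1 * (C * S - t) \<le> X * (C * S - t)" using X by (intro mult_right_mono) auto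
    then have "(S - t) * (C + 1) \<le> d" unfolding d_def by (simp add: algebra_simps)
    moreover have "0 < (S - t) * (C + 1)" using SC by simp
    ultimately have "0 < d" by linarith
    then have "0 < d / (S * S)" using SC by simp
    with D show "\<exists>d. ((\<lambda>y. (X * y * cosh y + y) / sinh y) has_real_derivative d) (at t) \<and> 0 < d"
      by blast
  qed
  then show False using R[of y1] R[of y2] assms by simp
qed

lemma antidiag_slope_root_unique:
  assumes "x > 0" "0 < y1" "0 < y2" "antidiag_slope x y1 = 0" "antidiag_slope x y2 = 0"
  shows "y1 = y2"
  using assms by (metis antidiag_slope_root_unique_aux linorder_neq_iff)

section \<open>Entropy in margin coordinates and its first-order conditions\<close>

definition psum :: "real \<Rightarrow> real \<Rightarrow> real \<Rightarrow> real" where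
  "psum x y z = exp (x + y + z) + exp x + exp y + exp z"

definition psum_log :: "real \<Rightarrow> real \<Rightarrow> real \<Rightarrow> real" where
  "psum_log x y z = exp (x + y + z) * (x + y + z) + exp x * x + exp y * y + exp z * z"

text \<open>Entropy in nats: for unnormalized weights e^l with total N, it equals ln N minus the
  weighted mean of the logarithms l.\<close>

definition margin_entropy :: "real \<Rightarrow> real \<times> real \<Rightarrow> real" where
  "margin_entropy x v = ln (psum x (fst v) (snd v)) - psum_log x (fst v) (snd v) / psum x (fst v) (snd v)"

lemma psum_pos: "0 < psum x y z"
  unfolding psum_def by (intro add_pos_pos) auto

lemma entropy2_Psi: "entropy2 (Psi (x, y, z)) = margin_entropy x (y, z) / ln 2"
proof -
  define N where "N = psum x y z"
  have N: "N > 0" by (simp add: N_def psum_pos)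
  have p: "plogp (exp a / N) = (exp a * a / N - exp a / N * ln N) / ln 2" for a
    using N by (simp add: plogp_def log_def ln_div field_simps)
  have "entropy2 (Psi (x, y, z)) = - (plogp (exp (x + y + z) / N) + plogp (exp y / N)
      + plogp (exp z / N) + plogp (exp x / N))"
    by (simp add: entropy2_eq Psi_nth N_def psum_def)
  also have "\<dots> = ((exp (x + y + z) + exp x + exp y + exp z) / N * ln N - psum_log x y z / N) / ln 2"
    unfolding p psum_log_def
    by (simp add: add_divide_distrib diff_divide_distrib distrib_right algebra_simps)
  also have "(exp (x + y + z) + exp x + exp y + exp z) / N = 1"
    using N by (simp add: N_def psum_def)
  finally show ?thesis by (simp add: margin_entropy_def N_def)
qed

lemma margin_entropy_swap: "margin_entropy x (z, y) = margin_entropy x (y, z)"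
  by (simp add: margin_entropy_def psum_def psum_log_def algebra_simps)

text \<open>\<open>R\<close> and \<open>A\<close> collect the first row, whose entries are those
  varying with y. The total has derivative R and \<open>psum_log\<close> has R + A, so the terms R/N
  cancel. The z-derivative follows by \<open>margin_entropy_swap\<close>.\<close>

lemma DERIV_margin_entropy:
  defines "A x y z \<equiv> exp (x + y + z) * (x + y + z) + exp y * y"
  defines "R x y z \<equiv> exp (x + y + z) + exp y"
  shows "((\<lambda>t. margin_entropy x (t, z)) has_real_derivative
    (psum_log x y z * R x y z - A x y z * psum x y z) / (psum x y z)\<^sup>2) (at y)"
proof -
  have N: "psum x y z > 0" by (rule psum_pos)
  have dN: "((\<lambda>t. psum x t z) has_real_derivative R x y z) (at y)"
    unfolding psum_def R_def by (auto intro!: derivative_eq_intros)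
  have dM: "((\<lambda>t. psum_log x t z) has_real_derivative R x y z + A x y z) (at y)"
    unfolding psum_log_def R_def A_def by (auto intro!: derivative_eq_intros simp: algebra_simps)
  have "((\<lambda>t. margin_entropy x (t, z)) has_real_derivative
     R x y z / psum x y z - ((R x y z + A x y z) * psum x y z - psum_log x y z * R x y z) / (psum x y z * psum x y z)) (at y)"
    unfolding margin_entropy_def fst_conv snd_conv using N
    by (auto intro!: derivative_eq_intros dN dM)
  then show ?thesis
    by (rule DERIV_cong) (use N in \<open>simp add: field_simps power2_eq_square\<close>)
qed

lemma local_extremum_DERIV_zero:
  fixes f :: "real \<Rightarrow> real"
  assumes "local_extremum f y" "(f has_real_derivative l) (at y)"
  shows "l = 0"
proof -
  from assms(1) consider "local_max f y" | "local_min f y" by (auto simp: local_extremum_def)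
  then show ?thesis
  proof cases
    case 1
    then obtain d where "d > 0" "\<forall>q. dist q y < d \<longrightarrow> f q \<le> f y"
      unfolding local_max_def eventually_nhds_metric by blast
    then show ?thesis
      using DERIV_local_max[OF assms(2), of d] by (simp add: dist_real_def abs_minus_commute)
  next
    case 2
    then obtain d where "d > 0" "\<forall>q. dist q y < d \<longrightarrow> f y \<le> f q"
      unfolding local_min_def eventually_nhds_metric by blast
    then show ?thesis
      using DERIV_local_min[OF assms(2), of d] by (simp add: dist_real_def abs_minus_commute)
  qed
qed

lemma local_max_compose:
  assumes "local_max f (g t)" "isCont g t" shows "local_max (\<lambda>s. f (g s)) t"
proof -
  have "filterlim g (nhds (g t)) (nhds t)"
    using assms(2) by (simp add: isCont_def tendsto_at_iff_tendsto_nhds)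
  with assms(1) show ?thesis unfolding local_max_def by (rule eventually_compose_filterlim)
qed

lemma local_min_iff_local_max: "local_min f p \<longleftrightarrow> local_max (\<lambda>q. - f q) p"
  by (simp add: local_min_def local_max_def)

lemma local_extremum_minus: "local_extremum (\<lambda>q. - f q) p \<longleftrightarrow> local_extremum f p"
  by (auto simp: local_extremum_def local_min_iff_local_max)

lemma local_extremum_compose:
  assumes "local_extremum f (g t)" "isCont g t" shows "local_extremum (\<lambda>s. f (g s)) t"
  using assms local_max_compose[of f g t] local_max_compose[of "\<lambda>q. - f q" g t]
  by (auto simp: local_extremum_def local_min_iff_local_max)

lemma mult_exp_strict_mono: "0 \<le> a \<Longrightarrow> a < b \<Longrightarrow> a * exp a < b * exp (b::real)"
  by (intro mult_strict_mono) auto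

text \<open>At a critical point of the entropy, with \<open>m\<close> the mean of the logarithms of the unnormalized
  entries, the deviations \<open>a, b, c, d\<close> of these logarithms from \<open>m\<close> satisfy
  \<open>a e\<^sup>a = d e\<^sup>d = - b e\<^sup>b = - c e\<^sup>c\<close>; since \<open>t \<mapsto> t e\<^sup>t\<close> is injective on positive numbers, the two
  diagonal entries agree.\<close>

lemma critical_point:
  assumes x: "x > 0" and ext: "local_extremum (margin_entropy x) (y, z)"
  shows "z = - y" "antidiag_slope x y = 0"
proof -
  define N M where "N = psum x y z" "M = psum_log x y z"
  have N: "N > 0" by (simp add: N_M_def psum_pos)
  define m where "m = M / N"
  have "local_extremum (\<lambda>t. margin_entropy x (t, z)) y"
    by (rule local_extremum_compose[where g = "\<lambda>t. (t, z)"]) (use ext in \<open>auto intro: continuous_intros\<close>)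
  from local_extremum_DERIV_zero[OF this DERIV_margin_entropy]
  have e1: "M * (exp (x + y + z) + exp y) = (exp (x + y + z) * (x + y + z) + exp y * y) * N"
    using N by (simp add: N_M_def)
  have "local_extremum (\<lambda>t. margin_entropy x (y, t)) z"
    by (rule local_extremum_compose[where g = "\<lambda>t. (y, t)"]) (use ext in \<open>auto intro: continuous_intros\<close>)
  then have "local_extremum (\<lambda>t. margin_entropy x (t, y)) z" by (simp add: margin_entropy_swap[of x y])
  from local_extremum_DERIV_zero[OF this DERIV_margin_entropy]
  have e2: "M * (exp (x + y + z) + exp z) = (exp (x + y + z) * (x + y + z) + exp z * z) * N"
    using N by (simp add: N_M_def psum_def psum_log_def ac_simps)
  have Mm: "M = m * N" using N by (simp add: m_def)
  define h where "h = (\<lambda>t::real. t * exp t)"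
  define a b c d where "a = x + y + z - m" "b = y - m" "c = z - m" "d = x - m"
  have hm: "h (t - m) = exp t * (t - m) * exp (- m)" for t
    by (simp add: h_def exp_diff exp_minus field_simps)
  have "exp (x + y + z) * (x + y + z - m) + exp y * (y - m) = 0"
  proof -
    have "(m * (exp (x + y + z) + exp y)) * N = (exp (x + y + z) * (x + y + z) + exp y * y) * N"
      using e1 unfolding Mm by (simp add: ac_simps)
    then show ?thesis using N unfolding mult_cancel_right by (simp add: algebra_simps)
  qed
  then have ab: "h a + h b = 0" by (simp add: a_b_c_d_def hm flip: distrib_right)
  have "exp (x + y + z) * (x + y + z - m) + exp z * (z - m) = 0"
  proof -
    have "(m * (exp (x + y + z) + exp z)) * N = (exp (x + y + z) * (x + y + z) + exp z * z) * N"
      using e2 unfolding Mm by (simp add: ac_simps)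
    then show ?thesis using N unfolding mult_cancel_right by (simp add: algebra_simps)
  qed
  then have ac: "h a + h c = 0" by (simp add: a_b_c_d_def hm flip: distrib_right)
  have "exp (x + y + z) * (x + y + z - m) + exp x * (x - m) + exp y * (y - m) + exp z * (z - m) = 0"
    using Mm unfolding N_M_def psum_def psum_log_def by (simp add: algebra_simps)
  then have "h a + h d + h b + h c = 0" by (simp add: a_b_c_d_def hm flip: distrib_right)
  with ab ac have hd: "h d = h a" and hbc: "h b = - h a" "h c = - h a" by linarith+
  have sgn: "h t > 0 \<longleftrightarrow> t > 0" "h t = 0 \<longleftrightarrow> t = 0" for t by (simp_all add: h_def zero_less_mult_iff)
  have inj: "s = t" if "h s = h t" "s > 0" "t > 0" for s t
  proof (rule ccontr)
    assume "s \<noteq> t"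
    then have "h s < h t \<or> h t < h s"
      using that(2,3) mult_exp_strict_mono[of s t] mult_exp_strict_mono[of t s]
      unfolding h_def by linarith
    with that(1) show False by linarith
  qed
  \<comment> \<open>The logarithm of the odds-ratio, positive here. It rules out the two remaining
    sign patterns: all deviations zero, or a, d nonpositive and b, c positive.\<close>
  have rel: "a + d - b - c = 2 * x" by (simp add: a_b_c_d_def)
  consider "h a > 0" | "h a = 0" | "h a < 0" by linarith
  then show z: "z = - y"
  proof cases
    case 1
    then have "a > 0" "d > 0" using sgn(1)[of a] sgn(1)[of d] unfolding hd by blast+
    with hd have "a = d" by (metis inj)
    then show ?thesis by (simp add: a_b_c_d_def)
  next
    case 2
    then have "h b = 0" "h c = 0" "h d = 0" using hd hbc by linarith+
    with 2 have "a = 0" "b = 0" "c = 0" "d = 0" unfolding sgn(2) by blast+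
    then show ?thesis using rel x by linarith
  next
    case 3
    then have "\<not> a > 0" "\<not> d > 0" "b > 0" "c > 0"
      using hd hbc sgn(1)[of a] sgn(1)[of b] sgn(1)[of c] sgn(1)[of d] by linarith+
    then show ?thesis using rel x by linarith
  qed
  define X Yp Yn where "X = exp x" "Yp = exp y" "Yn = exp (- y)"
  have "Yp * Yn = 1" by (simp add: X_Yp_Yn_def flip: exp_add)
  have "M * (X + Yp) - (X * x + Yp * y) * N = 0"
    using e1 unfolding z by (simp add: X_Yp_Yn_def)
  \<comment> \<open>Once the product of \<open>Yp\<close> and \<open>Yn\<close> is replaced by 1,
    the right-hand side is twice \<open>antidiag_slope x y\<close>.\<close>
  moreover have "M * (X + Yp) - (X * x + Yp * y) * N =
      X * x * (Yp - Yn) - X * y * (Yp + Yn) - 2 * y * (Yp * Yn)"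
    unfolding N_M_def psum_def psum_log_def z by (simp add: X_Yp_Yn_def[symmetric] algebra_simps)
  ultimately have "X * x * (Yp - Yn) - X * y * (Yp + Yn) - 2 * y = 0"
    unfolding \<open>Yp * Yn = 1\<close> by simp
  then show "antidiag_slope x y = 0"
    by (simp add: antidiag_slope_def sinh_def cosh_def X_Yp_Yn_def[symmetric] algebra_simps)
qed

text \<open>Along z = - y the entropy has derivative 4 \<open>antidiag_slope x s\<close> divided by
  the square of the total, so positivity of the slope is inherited.\<close>

lemma margin_entropy_antidiagonal_increasing:
  assumes "d > 0" "\<And>y. 0 < y \<Longrightarrow> y < d \<Longrightarrow> 0 < antidiag_slope x y" "0 < t" "t < d"
  shows "margin_entropy x (0, 0) < margin_entropy x (t, - t)"
proof -
  define X where "X = exp x"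
  define G where "G = (\<lambda>t. ln (2 * X + 2 * cosh t) - (2 * X * x + 2 * t * sinh t) / (2 * X + 2 * cosh t))"
  have X: "X > 0" by (simp add: X_def)
  have pos: "2 * X + 2 * cosh s > 0" for s :: real using X cosh_real_pos[of s] by linarith
  have E: "margin_entropy x (s, - s) = G s" for s
    by (simp add: margin_entropy_def psum_def psum_log_def G_def X_def cosh_def sinh_def algebra_simps)
  have "G 0 < G t"
  proof (rule DERIV_pos_imp_increasing_open[OF assms(3)])
    fix s assume s: "0 < s" "s < t"
    define N where "N = 2 * X + 2 * cosh s"
    have N: "N > 0" using pos by (simp add: N_def)
    have dN: "((\<lambda>s. 2 * X + 2 * cosh s) has_real_derivative 2 * sinh s) (at s)"
      by (auto intro!: derivative_eq_intros)
    have dM: "((\<lambda>s. 2 * X * x + 2 * s * sinh s) has_real_derivative 2 * sinh s + 2 * s * cosh s) (at s)"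
      by (auto intro!: derivative_eq_intros simp: algebra_simps)
    have "(G has_real_derivative 1 / N * (2 * sinh s) -
       ((2 * sinh s + 2 * s * cosh s) * N - (2 * X * x + 2 * s * sinh s) * (2 * sinh s)) / (N * N)) (at s)"
      unfolding G_def N_def using pos[of s]
      by (intro DERIV_diff DERIV_divide DERIV_chain2[OF DERIV_ln_divide] dN dM) auto
    also have "1 / N * (2 * sinh s) - ((2 * sinh s + 2 * s * cosh s) * N - (2 * X * x + 2 * s * sinh s) * (2 * sinh s)) / (N * N)
       = ((2 * X * x + 2 * s * sinh s) * (2 * sinh s) - 2 * s * cosh s * N) / (N * N)"
      using N by (simp add: field_simps)
    also have "(2 * X * x + 2 * s * sinh s) * (2 * sinh s) - 2 * s * cosh s * N =
        4 * (X * (x * sinh s - s * cosh s) - s * (cosh s * cosh s - sinh s * sinh s))"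
      unfolding N_def by (simp add: algebra_simps)
    also have "\<dots> = 4 * antidiag_slope x s"
      using hyperbolic_pythagoras[of s] by (simp add: antidiag_slope_def X_def power2_eq_square)
    finally have "(G has_real_derivative 4 * antidiag_slope x s / (N * N)) (at s)" .
    moreover have "4 * antidiag_slope x s / (N * N) > 0" using N assms(2)[of s] s assms(4) by simp
    ultimately show "\<exists>d. (G has_real_derivative d) (at s) \<and> 0 < d" by blast
  next
    show "continuous_on {0..t} G"
      unfolding G_def using pos by (intro continuous_intros) (auto simp: less_imp_neq[THEN not_sym])
  qed
  then show ?thesis using E[of 0] E[of t] by simp
qed

text \<open>Along z = y the numerator of the derivative is minus a sum of products that are positive
  for x, s > 0. This holds on both sides of the threshold and excludes a local minimum at the
  origin.\<close>

lemma margin_entropy_diagonal_decreasing: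
  assumes "x > 0" "t > 0" shows "margin_entropy x (t, t) < margin_entropy x (0, 0)"
proof -
  define X where "X = exp x"
  have X: "X > 0" by (simp add: X_def)
  define N where "N = (\<lambda>s. X * (exp s)\<^sup>2 + X + 2 * exp s)"
  define M where "M = (\<lambda>s. X * (exp s)\<^sup>2 * (x + 2 * s) + X * x + 2 * s * exp s)"
  have N: "N s > 0" for s unfolding N_def using X by (intro add_pos_pos) auto
  have e: "exp (x + s + s) = X * (exp s)\<^sup>2" for s
    unfolding X_def exp_add power2_eq_square by simp
  have E: "margin_entropy x (s, s) = ln (N s) - M s / N s" for s
  proof -
    have "psum x s s = N s" unfolding psum_def e N_def by (simp add: X_def)
    moreover have "psum_log x s s = M s"
      unfolding psum_log_def e M_def by (simp add: X_def algebra_simps)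
    ultimately show ?thesis by (simp add: margin_entropy_def)
  qed
  have "ln (N t) - M t / N t < ln (N 0) - M 0 / N 0"
  proof (rule DERIV_neg_imp_decreasing_open[OF assms(2)])
    fix s assume s: "0 < s" "s < t"
    define T where "T = exp s"
    have T: "T > 1" using s by (simp add: T_def)
    define N' where "N' = 2 * X * T\<^sup>2 + 2 * T"
    define A where "A = 2 * X * T\<^sup>2 * (x + 2 * s) + 2 * s * T"
    have dN: "(N has_real_derivative N') (at s)"
      unfolding N_def N'_def T_def by (auto intro!: derivative_eq_intros simp: power2_eq_square algebra_simps)
    have dM: "(M has_real_derivative N' + A) (at s)"
      unfolding M_def N'_def A_def T_def by (auto intro!: derivative_eq_intros simp: power2_eq_square algebra_simps)
    have "((\<lambda>s. ln (N s) - M s / N s) has_real_derivative N' / N s - ((N' + A) * N s - M s * N') / (N s * N s)) (at s)"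
      using N[of s] by (auto intro!: derivative_eq_intros dN dM)
    also have "N' / N s - ((N' + A) * N s - M s * N') / (N s * N s) = (M s * N' - A * N s) / (N s * N s)"
      using N[of s] by (simp add: field_simps)
    also have "M s * N' - A * N s = - (2 * T * X * (2 * s * X * T + x * (T\<^sup>2 - 1) + s * (T\<^sup>2 + 1)))"
      unfolding N'_def A_def N_def M_def T_def[symmetric]
      by (simp add: power2_eq_square algebra_simps)
    finally have D: "((\<lambda>s. ln (N s) - M s / N s) has_real_derivative
       - (2 * T * X * (2 * s * X * T + x * (T\<^sup>2 - 1) + s * (T\<^sup>2 + 1))) / (N s * N s)) (at s)" .
    have "T\<^sup>2 > 1" using T by (simp add: one_less_power)
    then have "2 * s * X * T + x * (T\<^sup>2 - 1) + s * (T\<^sup>2 + 1) > 0"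
      using s X T assms(1) by (intro add_pos_pos mult_pos_pos) auto
    then have "- (2 * T * X * (2 * s * X * T + x * (T\<^sup>2 - 1) + s * (T\<^sup>2 + 1))) / (N s * N s) < 0"
      using N[of s] X T by (intro divide_neg_pos) auto
    with D show "\<exists>d. ((\<lambda>s. ln (N s) - M s / N s) has_real_derivative d) (at s) \<and> d < 0" by blast
  next
    have "N s \<noteq> 0" for s using N[of s] by simp
    then show "continuous_on {0..t} (\<lambda>s. ln (N s) - M s / N s)"
      by (intro continuous_intros) (auto simp: N_def M_def intro!: continuous_intros)
  qed
  then show ?thesis by (simp add: E)
qed

subsection \<open>Extrema of the margin weighting function\<close>

lemma margin_weight_eq:
  "margin_weight (HS n) x v = spow (tanh (x / 2)) (exp (n * (hdiag (tanh (x / 2)) - margin_entropy x v / ln 2)))"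
  by (cases v) (simp add: margin_weight_def HS_Psi HS_of_def entropy2_Psi)

lemma margin_weight_less_iff:
  assumes "n > 0" "x > 0"
  shows "margin_weight (HS n) x v < margin_weight (HS n) x w \<longleftrightarrow> margin_entropy x v < margin_entropy x w"
  unfolding margin_weight_eq using assms
  by (subst spow_strict_antimono) (auto simp: tanh_real_lt_1 divide_less_cancel)

lemma local_max_margin_weight:
  assumes "n > 0" "x > 0"
  shows "local_max (margin_weight (HS n) x) v \<longleftrightarrow> local_max (margin_entropy x) v"
    "local_extremum (margin_weight (HS n) x) v \<longleftrightarrow> local_extremum (margin_entropy x) v"
proof -
  have "margin_weight (HS n) x v \<le> margin_weight (HS n) x w \<longleftrightarrow> margin_entropy x v \<le> margin_entropy x w" for v w
    using margin_weight_less_iff[OF assms, of w v] by (simp add: not_less[symmetric])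
  then show "local_max (margin_weight (HS n) x) v \<longleftrightarrow> local_max (margin_entropy x) v"
    "local_extremum (margin_weight (HS n) x) v \<longleftrightarrow> local_extremum (margin_entropy x) v"
    by (simp_all add: local_max_def local_min_def local_extremum_def)
qed

lemma margin_weight_origin: "margin_weight (HS n) x (0, 0) = tanh (x / 2)"
proof -
  have "diagonal_table (Psi (x, 0, 0))" by (simp add: diagonal_table_def Psi_nth)
  then show ?thesis
    using measures_at_diagonal_tables(1)[OF Psi_in_tables, of x 0 0 n]
    by (simp add: margin_weight_def Yule_Y_Psi)
qed

lemma continuous_on_margin_weight:
  assumes "n \<ge> 0" shows "continuous_on S (margin_weight (HS n) x)"
proof -
  have s: "continuous_on UNIV logistic" by (simp add: continuous_on_eq_continuous_at isCont_logistic)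
  have "continuous_on S (\<lambda>v. cube_HS n (logistic x, logistic (fst v), logistic (snd v)))"
    by (rule continuous_on_compose2[OF continuous_on_cube_HS[OF assms]])
      (use logistic_in in \<open>auto intro!: continuous_intros continuous_on_compose2[OF s]\<close>)
  moreover have "margin_weight (HS n) x = (\<lambda>v. cube_HS n (logistic x, logistic (fst v), logistic (snd v)))"
    by (auto simp: margin_weight_def HS_Psi_cube)
  ultimately show ?thesis by simp
qed

text \<open>The case n = 1 serves as a bounded proxy for the entropy: outside a ball it is at most
  c, below its value at the origin, so the maximum over the compact ball is global. The modulus of b
  ensures that the ball contains the origin.\<close>

lemma margin_entropy_attains_max:
  assumes "x > 0" obtains v0 where "\<And>v. margin_entropy x v \<le> margin_entropy x v0"
proof -
  let ?f = "margin_weight (HS 1) x"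
  obtain c where c: "c < tanh (x / 2)" "\<forall>\<^sub>F v in at_infinity. ?f v \<le> c"
    using eventually_margin_weight_le[of 1 x] assms by auto
  then obtain b where b: "\<And>v. norm v \<ge> b \<Longrightarrow> ?f v \<le> c"
    unfolding eventually_at_infinity by auto
  have "\<exists>v0\<in>cball 0 \<bar>b\<bar>. \<forall>v\<in>cball 0 \<bar>b\<bar>. ?f v \<le> ?f v0"
    by (intro continuous_attains_sup continuous_on_margin_weight) auto
  then obtain v0 where v0: "\<And>v. v \<in> cball 0 \<bar>b\<bar> \<Longrightarrow> ?f v \<le> ?f v0" by blast
  have "?f v \<le> ?f v0" for v
  proof (cases "v \<in> cball 0 \<bar>b\<bar>")
    case False
    then have "?f v \<le> c" by (intro b) auto
    also have "\<dots> \<le> ?f (0, 0)" using c(1) by (simp add: margin_weight_origin)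
    also have "\<dots> \<le> ?f v0" by (rule v0) (simp flip: zero_prod_def)
    finally show ?thesis .
  qed (rule v0)
  then have "margin_entropy x v \<le> margin_entropy x v0" for v
    using margin_weight_less_iff[of 1 x v0 v] assms by (simp add: not_less[symmetric])
  then show ?thesis by (rule that)
qed

lemma local_max_if_max: "(\<And>q. f q \<le> f p) \<Longrightarrow> local_max f p"
  by (simp add: local_max_def)

lemma critical_point_cases:
  assumes "x > 0" "local_extremum (margin_entropy x) v" "v \<noteq> (0, 0)"
  obtains y where "v = (y, - y)" "y \<noteq> 0" "antidiag_slope x \<bar>y\<bar> = 0"
proof -
  obtain y z where v: "v = (y, z)" by fastforce
  with critical_point[OF assms(1)] assms(2) have "z = - y" "antidiag_slope x y = 0" by auto
  moreover from this have "antidiag_slope x \<bar>y\<bar> = 0" by (cases "y \<ge> 0") (auto simp: antidiag_slope_minus)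
  ultimately show ?thesis using that[of y] assms(3) v by auto
qed

text \<open>A global maximum exists and is critical, and below the threshold only the origin is
  critical. A second point with the same value would be another global maximum, hence critical too;
  this gives strictness.\<close>

lemma only_max_at_origin:
  assumes "n > 0" "x > 0" "(x - 1) * exp x < 1"
  shows "only_max_at (margin_weight (HS n) x) (0, 0)"
proof -
  have crit: "v = (0, 0)" if v: "local_extremum (margin_entropy x) v" for v
  proof (rule ccontr)
    assume "v \<noteq> (0, 0)"
    obtain y where "v = (y, - y)" "y \<noteq> 0" "antidiag_slope x \<bar>y\<bar> = 0"
      by (rule critical_point_cases[OF assms(2) v \<open>v \<noteq> (0, 0)\<close>])
    then show False using antidiag_slope_neg_below_threshold[OF assms(2,3), of "\<bar>y\<bar>"] by simp
  qed
  have crit_max: "v = (0, 0)" if "local_max (margin_entropy x) v" for v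
    using crit that by (simp add: local_extremum_def)
  have max0: "q = (0, 0)" if "\<And>v. margin_entropy x v \<le> margin_entropy x q" for q
    by (rule crit_max[OF local_max_if_max]) (rule that)
  obtain v0 where v0: "\<And>v. margin_entropy x v \<le> margin_entropy x v0" using margin_entropy_attains_max[OF assms(2)] by blast
  have "v0 = (0, 0)" by (rule max0[OF v0])
  with v0 have le: "margin_entropy x v \<le> margin_entropy x (0, 0)" for v by blast
  have less: "margin_entropy x q < margin_entropy x (0, 0)" if "q \<noteq> (0, 0)" for q
  proof (rule ccontr)
    assume "\<not> margin_entropy x q < margin_entropy x (0, 0)"
    with le have "\<And>v. margin_entropy x v \<le> margin_entropy x q" by (meson not_less order_trans)
    from max0[OF this] that show False by contradiction
  qed
  show ?thesis
    unfolding only_max_at_def margin_weight_less_iff[OF assms(1,2)] local_max_margin_weight[OF assms(1,2)]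
  proof (intro conjI allI impI iffI)
    fix q assume "local_max (margin_entropy x) q"
    then show "q = (0, 0)" by (rule crit_max)
  next
    fix q :: "real \<times> real" assume "q = (0, 0)"
    then show "local_max (margin_entropy x) q" using le by (intro local_max_if_max) simp
  qed (rule less)
qed

text \<open>\<open>saddle_point\<close> asks for a total derivative, so vanishing partial
  derivatives would not suffice. The entropy is differentiated in both variables at once, and the
  chain rule carries the zero over.\<close>

lemma margin_weight_has_derivative_origin:
  assumes "x > 0"
  shows "(margin_weight (HS n) x has_derivative (\<lambda>_. 0)) (at (0, 0))"
proof -
  define X where "X = exp x"
  have X: "X > 0" by (simp add: X_def)
  \<comment> \<open>The power written out through exp and ln, legitimate since tanh (x/2) > 0, as a
    differentiable function of the entropy e.\<close>
  define g where "g = (\<lambda>e. exp (exp (n * (hdiag (tanh (x / 2)) - e / ln 2)) * ln (tanh (x / 2))))"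
  have "\<exists>D. (g has_real_derivative D) (at (margin_entropy x (0, 0)))"
    unfolding g_def by (intro exI) (rule derivative_eq_intros refl | simp)+
  then obtain D where D: "(g has_real_derivative D) (at (margin_entropy x (0, 0)))" by blast
  have dN: "((\<lambda>v. psum x (fst v) (snd v)) has_derivative (\<lambda>h. (X + 1) * (fst h + snd h))) (at (0, 0))"
    unfolding psum_def X_def
    by (auto intro!: derivative_eq_intros simp: algebra_simps)
  have dM: "((\<lambda>v. psum_log x (fst v) (snd v)) has_derivative (\<lambda>h. (X * x + X + 1) * (fst h + snd h))) (at (0, 0))"
    unfolding psum_log_def X_def
    by (auto intro!: derivative_eq_intros simp: algebra_simps)
  have psum_nz: "psum x y z \<noteq> 0" for y z using psum_pos[of x y z] by simp
  have N0: "psum x (fst (0, 0)) (snd (0, 0)) = 2 * X + 2" "psum_log x (fst (0, 0)) (snd (0, 0)) = 2 * X * x"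
    by (simp_all add: psum_def psum_log_def X_def)
  have "(margin_entropy x has_derivative (\<lambda>h. ((X + 1) * (fst h + snd h)) * inverse (2 * X + 2) -
      (((X * x + X + 1) * (fst h + snd h)) * (2 * X + 2) - (2 * X * x) * ((X + 1) * (fst h + snd h))) /
       ((2 * X + 2) * (2 * X + 2)))) (at (0, 0))"
    unfolding margin_entropy_def[abs_def]
    using has_derivative_diff[OF has_derivative_ln[OF psum_pos dN] has_derivative_divide'[OF dM dN psum_nz]]
    unfolding N0 .
  also have "(\<lambda>h. ((X + 1) * (fst h + snd h)) * inverse (2 * X + 2) -
      (((X * x + X + 1) * (fst h + snd h)) * (2 * X + 2) - (2 * X * x) * ((X + 1) * (fst h + snd h))) /
       ((2 * X + 2) * (2 * X + 2))) = (\<lambda>_. 0)"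
  proof
    fix h :: "real \<times> real"
    define k where "k = fst h + snd h"
    have "((X * x + X + 1) * k) * (2 * X + 2) - (2 * X * x) * ((X + 1) * k) = ((X + 1) * k) * (2 * X + 2)"
      by (simp add: algebra_simps)
    then show "((X + 1) * (fst h + snd h)) * inverse (2 * X + 2) -
      (((X * x + X + 1) * (fst h + snd h)) * (2 * X + 2) - (2 * X * x) * ((X + 1) * (fst h + snd h))) /
       ((2 * X + 2) * (2 * X + 2)) = 0"
      unfolding k_def[symmetric] using X by (simp add: inverse_eq_divide)
  qed
  finally have dE: "(margin_entropy x has_derivative (\<lambda>_. 0)) (at (0, 0))" .
  have "((\<lambda>v. g (margin_entropy x v)) has_derivative (\<lambda>h. D * 0)) (at (0, 0))"
    using has_derivative_compose[OF dE, of g "(*) D"] D by (simp add: has_field_derivative_def)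
  moreover have "margin_weight (HS n) x = (\<lambda>v. g (margin_entropy x v))"
    using assms by (auto simp: margin_weight_eq g_def spow_def powr_def fun_eq_iff)
  ultimately show ?thesis by simp
qed

text \<open>Growth along z = - y near the origin excludes a maximum, and decay along z = y excludes
  a minimum.\<close>

lemma origin_not_extremum:
  assumes "x > 0" "(x - 1) * exp x > 1"
  shows "\<not> local_extremum (margin_entropy x) (0, 0)"
proof
  assume "local_extremum (margin_entropy x) (0, 0)"
  then consider "local_max (margin_entropy x) (0, 0)" | "local_min (margin_entropy x) (0, 0)"
    by (auto simp: local_extremum_def)
  then show False
  proof cases
    case 1
    then have "local_max (\<lambda>t. margin_entropy x (t, - t)) 0"
      using local_max_compose[of "margin_entropy x" "\<lambda>t. (t, - t)" "0::real"] by (simp add: continuous_intros)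
    then obtain e where e: "e > 0" "\<And>t. \<bar>t\<bar> < e \<Longrightarrow> margin_entropy x (t, - t) \<le> margin_entropy x (0, 0)"
      unfolding local_max_def eventually_nhds_metric by (auto simp: dist_real_def)
    obtain d where d: "d > 0" "\<And>y. 0 < y \<Longrightarrow> y < d \<Longrightarrow> 0 < antidiag_slope x y"
      using antidiag_slope_pos_above_threshold[OF assms(2)] by blast
    define t where "t = min d e / 2"
    have t: "0 < t" "t < d" "\<bar>t\<bar> < e" using d(1) e(1) by (auto simp: t_def min_def)
    show False using margin_entropy_antidiagonal_increasing[OF d t(1,2)] e(2)[OF t(3)] by simp
  next
    case 2
    then have "local_max (\<lambda>t. - margin_entropy x (t, t)) 0"
      using local_max_compose[of "\<lambda>q. - margin_entropy x q" "\<lambda>t. (t, t)" "0::real"]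
      by (simp add: continuous_intros local_min_iff_local_max)
    then obtain e where e: "e > 0" "\<And>t. \<bar>t\<bar> < e \<Longrightarrow> margin_entropy x (0, 0) \<le> margin_entropy x (t, t)"
      unfolding local_max_def eventually_nhds_metric by (auto simp: dist_real_def)
    show False
      using margin_entropy_diagonal_decreasing[OF assms(1), of "e / 2"] e(1) e(2)[of "e / 2"] by simp
  qed
qed

text \<open>The global maximum is not at the origin, so it is some (y, -y) with y nonzero;
  exchanging the coordinates gives its twin. Uniqueness of the positive root excludes further
  extrema, so both are global maxima.\<close>

lemma extrema_above_threshold:
  assumes "x > 0" "(x - 1) * exp x > 1"
  obtains y where "y > 0" "{v. v \<noteq> (0, 0) \<and> local_extremum (margin_entropy x) v} = {(y, - y), (- y, y)}"
proof -
  obtain v0 where v0: "\<And>v. margin_entropy x v \<le> margin_entropy x v0" using margin_entropy_attains_max[OF assms(1)] by blast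
  then have ext0: "local_extremum (margin_entropy x) v0"
    unfolding local_extremum_def by (intro disjI1 local_max_if_max)
  then have "v0 \<noteq> (0, 0)" using origin_not_extremum[OF assms] by auto
  then obtain y0 where y0: "v0 = (y0, - y0)" "y0 \<noteq> 0" "antidiag_slope x \<bar>y0\<bar> = 0"
    by (rule critical_point_cases[OF assms(1) ext0])
  define y where "y = \<bar>y0\<bar>"
  have y: "y > 0" "antidiag_slope x y = 0" using y0 by (simp_all add: y_def)
  have "margin_entropy x (y, - y) = margin_entropy x v0" "margin_entropy x (- y, y) = margin_entropy x v0"
    using margin_entropy_swap[of x y0 "- y0"] unfolding y_def y0(1) by (auto simp: abs_real_def)
  then have "local_extremum (margin_entropy x) (y, - y)" "local_extremum (margin_entropy x) (- y, y)"
    using v0 local_max_if_max[of "margin_entropy x"] by (auto simp: local_extremum_def)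
  moreover have "v \<in> {(y, - y), (- y, y)}" if v: "v \<noteq> (0, 0)" "local_extremum (margin_entropy x) v" for v
  proof -
    obtain t where t: "v = (t, - t)" "t \<noteq> 0" "antidiag_slope x \<bar>t\<bar> = 0"
      by (rule critical_point_cases[OF assms(1) v(2,1)])
    then have "\<bar>t\<bar> = y" using antidiag_slope_root_unique[OF assms(1) _ y(1) _ y(2), of "\<bar>t\<bar>"] by simp
    then show ?thesis using t by (auto simp: abs_real_def split: if_splits)
  qed
  ultimately have "{v. v \<noteq> (0, 0) \<and> local_extremum (margin_entropy x) v} = {(y, - y), (- y, y)}"
    using y(1) by auto
  with y(1) show ?thesis by (rule that)
qed

text \<open>Up to normalization the main diagonal is e^x, e^x and the other one is e^y, e^(-y). The
  smaller of the latter is below 1 < e^x.\<close>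

lemma one_small_entry_antidiagonal:
  assumes "x > 0" "y \<noteq> 0" shows "one_small_entry (Psi (x, y, - y))"
proof -
  define N where "N = exp (x + y + - y) + exp x + exp y + exp (- y)"
  have N: "N > 0" using Psi_nth(5)[of x y "- y"] by (simp add: N_def)
  show ?thesis
    using assms(1,2) N unfolding one_small_entry_def Psi_nth N_def[symmetric]
    by (cases "y > 0") (auto simp: divide_strict_right_mono)
qed

text \<open>The column swap \<open>(x, y, z) \<mapsto> (- x, y, - z)\<close> transfers the case \<open>x > 0\<close> to \<open>x < 0\<close>.\<close>

definition flip_snd :: "real \<times> real \<Rightarrow> real \<times> real" where "flip_snd v = (fst v, - snd v)"

lemma flip_snd_simps [simp]: "flip_snd (flip_snd v) = v" "flip_snd (0, 0) = (0, 0)" "flip_snd (y, z) = (y, - z)"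
  by (simp_all add: flip_snd_def)

lemma flip_snd_eq_origin [simp]: "flip_snd v = (0, 0) \<longleftrightarrow> v = (0, 0)"
  by (cases v) simp

lemma isCont_flip_snd: "isCont flip_snd v"
  unfolding flip_snd_def[abs_def] by (intro continuous_intros)

lemma local_max_flip_snd: "local_max (\<lambda>v. f (flip_snd v)) v \<longleftrightarrow> local_max f (flip_snd v)"
  using local_max_compose[of f flip_snd v, OF _ isCont_flip_snd]
    local_max_compose[of "\<lambda>v. f (flip_snd v)" flip_snd "flip_snd v", OF _ isCont_flip_snd] by auto

lemma local_extremum_flip_snd: "local_extremum (\<lambda>v. f (flip_snd v)) v \<longleftrightarrow> local_extremum f (flip_snd v)"
  using local_max_flip_snd[of f v] local_max_flip_snd[of "\<lambda>q. - f q" v]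
  by (simp add: local_extremum_def local_min_iff_local_max)

lemma only_max_at_flip_snd:
  assumes "only_max_at f (0, 0)" shows "only_max_at (\<lambda>v. f (flip_snd v)) (0, 0)"
  using assms unfolding only_max_at_def local_max_flip_snd by auto

lemma margin_weight_flip_snd: "margin_weight (HS n) x = (\<lambda>v. - margin_weight (HS n) (- x) (flip_snd v))"
  using margin_weight_minus[of n "- x"] by (auto simp: flip_snd_def)

lemma one_small_entry_flip: "one_small_entry (Psi (x, y, z)) \<longleftrightarrow> one_small_entry (Psi (- x, y, - z))"
  using Psi_minus[of x y "- z"] unfolding one_small_entry_def by auto

lemma saddle_and_extrema_pos:
  assumes "n > 0" "x > 0" "(x - 1) * exp x > 1"
  shows "saddle_point (margin_weight (HS n) x) (0, 0)"
    "card {v. v \<noteq> (0, 0) \<and> local_extremum (margin_weight (HS n) x) v} = 2"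
    "(y, z) \<noteq> (0, 0) \<Longrightarrow> local_extremum (margin_weight (HS n) x) (y, z) \<Longrightarrow> one_small_entry (Psi (x, y, z))"
proof -
  note ext = local_max_margin_weight(2)[OF assms(1,2)]
  show "saddle_point (margin_weight (HS n) x) (0, 0)"
    unfolding saddle_point_def ext
    using margin_weight_has_derivative_origin[OF assms(2)] origin_not_extremum[OF assms(2,3)] by blast
  obtain y0 where "y0 > 0" "{v. v \<noteq> (0, 0) \<and> local_extremum (margin_entropy x) v} = {(y0, - y0), (- y0, y0)}"
    using extrema_above_threshold[OF assms(2,3)] by blast
  then show "card {v. v \<noteq> (0, 0) \<and> local_extremum (margin_weight (HS n) x) v} = 2"
    unfolding ext by simp
  assume a: "(y, z) \<noteq> (0, 0)" "local_extremum (margin_weight (HS n) x) (y, z)"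
  obtain t where "(y, z) = (t, - t)" "t \<noteq> 0"
    by (rule critical_point_cases[OF assms(2) a(2)[unfolded ext] a(1)])
  then show "one_small_entry (Psi (x, y, z))" using one_small_entry_antidiagonal[OF assms(2)] by simp
qed

lemma saddle_and_extrema_neg:
  assumes "n > 0" "x < 0" "(- x - 1) * exp (- x) > 1"
  shows "saddle_point (margin_weight (HS n) x) (0, 0)"
    "card {v. v \<noteq> (0, 0) \<and> local_extremum (margin_weight (HS n) x) v} = 2"
    "(y, z) \<noteq> (0, 0) \<Longrightarrow> local_extremum (margin_weight (HS n) x) (y, z) \<Longrightarrow> one_small_entry (Psi (x, y, z))"
proof -
  have "- x > 0" using assms by simp
  note pos = saddle_and_extrema_pos[OF assms(1) this assms(3)]
  have ext: "local_extremum (margin_weight (HS n) x) v \<longleftrightarrow> local_extremum (margin_weight (HS n) (- x)) (flip_snd v)" for v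
    by (subst margin_weight_flip_snd) (simp add: local_extremum_minus local_extremum_flip_snd)
  have d: "(margin_weight (HS n) (- x) has_derivative (\<lambda>_. 0)) (at (flip_snd (0, 0)))"
    using pos(1) by (simp add: saddle_point_def)
  have "bounded_linear flip_snd" unfolding flip_snd_def[abs_def]
    by (intro bounded_linear_Pair bounded_linear_fst bounded_linear_minus bounded_linear_snd)
  then have "(flip_snd has_derivative flip_snd) (at (0, 0))" by (rule bounded_linear_imp_has_derivative)
  from has_derivative_compose[OF this d]
  have "((\<lambda>v. - margin_weight (HS n) (- x) (flip_snd v)) has_derivative (\<lambda>_. - 0)) (at (0, 0))"
    by (rule has_derivative_minus)
  then have "(margin_weight (HS n) x has_derivative (\<lambda>_. 0)) (at (0, 0))"
    by (subst margin_weight_flip_snd) simp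
  then show "saddle_point (margin_weight (HS n) x) (0, 0)"
    using pos(1) by (simp add: saddle_point_def ext)
  have "{v. v \<noteq> (0, 0) \<and> local_extremum (margin_weight (HS n) x) v} =
      flip_snd ` {v. v \<noteq> (0, 0) \<and> local_extremum (margin_weight (HS n) (- x)) v}"
  proof (intro equalityI subsetI)
    fix v assume "v \<in> {v. v \<noteq> (0, 0) \<and> local_extremum (margin_weight (HS n) x) v}"
    then show "v \<in> flip_snd ` {v. v \<noteq> (0, 0) \<and> local_extremum (margin_weight (HS n) (- x)) v}"
      by (intro image_eqI[of v flip_snd "flip_snd v"]) (auto simp: ext)
  qed (auto simp: ext)
  moreover have "inj flip_snd" by (rule inj_on_inverseI[where g = flip_snd]) simp
  ultimately show "card {v. v \<noteq> (0, 0) \<and> local_extremum (margin_weight (HS n) x) v} = 2"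
    using pos(2) by (simp add: card_image inj_on_subset)
  show "one_small_entry (Psi (x, y, z))"
    if "(y, z) \<noteq> (0, 0)" "local_extremum (margin_weight (HS n) x) (y, z)"
    using that pos(3)[of y "- z"] unfolding ext one_small_entry_flip[of x y z] by simp
qed

section \<open>The threshold 1 + W(1/e)\<close>

lemma lambert_W_inverse_e:
  obtains w where "lambert_W (1 / exp 1) = w" "0 < w" "w * exp w = exp (- 1)"
proof -
  have "\<exists>w\<ge>0. w \<le> 1 \<and> w * exp w = exp (- 1 :: real)"
    by (rule IVT') (auto intro!: continuous_intros)
  then obtain w where w: "w \<ge> 0" "w * exp w = exp (- 1 :: real)" by blast
  then have "w > 0" by (cases "w = 0") auto
  have "lambert_W (1 / exp 1) = w" unfolding lambert_W_def
  proof (rule the_equality)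
    show "- 1 \<le> w \<and> w * exp w = 1 / exp 1" using w by (simp add: exp_minus inverse_eq_divide)
    fix v :: real assume v: "- 1 \<le> v \<and> v * exp v = 1 / exp 1"
    \<comment> \<open>A positive value forces v > 0, and there v e^v is strictly increasing.\<close>
    then have "v * exp v > 0" by simp
    then have "v > 0" by (simp add: zero_less_mult_iff)
    moreover have "v * exp v = w * exp w" using v w by (simp add: exp_minus inverse_eq_divide)
    ultimately show "v = w"
      using mult_exp_strict_mono[of v w] mult_exp_strict_mono[of w v] \<open>w > 0\<close>
      by (cases v w rule: linorder_cases) auto
  qed
  then show ?thesis using that \<open>w > 0\<close> w(2) by blast
qed

lemma threshold:
  assumes "x > 0"
  shows "x < 1 + lambert_W (1 / exp 1) \<Longrightarrow> (x - 1) * exp x < 1"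
    "x > 1 + lambert_W (1 / exp 1) \<Longrightarrow> (x - 1) * exp x > 1"
proof -
  obtain w where w: "lambert_W (1 / exp 1) = w" "0 < w" "w * exp w = exp (- 1)"
    by (rule lambert_W_inverse_e)
  have e: "(x - 1) * exp x = ((x - 1) * exp (x - 1)) * exp 1" by (simp add: exp_diff)
  have w1: "(w * exp w) * exp 1 = 1" unfolding w(3) by (simp flip: exp_add)
  show "(x - 1) * exp x < 1" if "x < 1 + lambert_W (1 / exp 1)"
  proof (cases "x \<ge> 1")
    case True
    then have "(x - 1) * exp (x - 1) < w * exp w"
      using that w by (intro mult_exp_strict_mono) auto
    then have "((x - 1) * exp (x - 1)) * exp 1 < (w * exp w) * exp 1" by simp
    then show ?thesis unfolding e w1 .
  next
    case False
    then have "(x - 1) * exp x < 0" by (simp add: mult_neg_pos)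
    then show ?thesis by simp
  qed
  show "(x - 1) * exp x > 1" if "x > 1 + lambert_W (1 / exp 1)"
  proof -
    have "w * exp w < (x - 1) * exp (x - 1)"
      using that w by (intro mult_exp_strict_mono) auto
    then have "(w * exp w) * exp 1 < ((x - 1) * exp (x - 1)) * exp 1" by simp
    then show ?thesis unfolding e w1 .
  qed
qed

theorem proposition10:
  fixes n :: real
  assumes "n \<ge> 0"
  shows
    "(\<forall>x::real. x \<noteq> 0 \<longrightarrow>
        (n > 0 \<longrightarrow>
          (x \<in> {- 1 - lambert_W (1 / exp 1) <..< 1 + lambert_W (1 / exp 1)} \<longrightarrow>
             (x > 0 \<longrightarrow> only_max_at (margin_weight (HS n) x) (0, 0)) \<and>
             (x < 0 \<longrightarrow> only_min_at (margin_weight (HS n) x) (0, 0))) \<and>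
          (x < - 1 - lambert_W (1 / exp 1) \<or> x > 1 + lambert_W (1 / exp 1) \<longrightarrow>
             saddle_point (margin_weight (HS n) x) (0, 0) \<and>
             card {v. v \<noteq> (0, 0) \<and> local_extremum (margin_weight (HS n) x) v} = 2 \<and>
             (\<forall>y z. (y, z) \<noteq> (0, 0) \<and> local_extremum (margin_weight (HS n) x) (y, z) \<longrightarrow>
                one_small_entry (Psi (x, y, z))))))
     \<and> (\<forall>x::real. x \<noteq> 0 \<longrightarrow>
        uniform_limit UNIV (\<lambda>y z. margin_weight (HS n) x (y, z))
          (\<lambda>z. HS_limit n x (inverse (1 + exp (x + z)))) at_top \<and>
        uniform_limit UNIV (\<lambda>y z. margin_weight (HS n) x (y, z))
          (\<lambda>z. HS_limit n x (inverse (1 + exp (x - z)))) at_bot \<and>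
        uniform_limit UNIV (\<lambda>z y. margin_weight (HS n) x (y, z))
          (\<lambda>y. HS_limit n x (inverse (1 + exp (x + y)))) at_top \<and>
        uniform_limit UNIV (\<lambda>z y. margin_weight (HS n) x (y, z))
          (\<lambda>y. HS_limit n x (inverse (1 + exp (x - y)))) at_bot \<and>
        (\<forall>w. inverse (1 + exp (x + w)) = 1 / 2 \<longleftrightarrow> w = - x) \<and>
        local_extremum (\<lambda>w. HS_limit n x (inverse (1 + exp (x + w)))) (- x) \<and>
        (\<forall>w. inverse (1 + exp (x - w)) = 1 / 2 \<longleftrightarrow> w = x) \<and>
        local_extremum (\<lambda>w. HS_limit n x (inverse (1 + exp (x - w)))) x)
     \<and> uniform_limit UNIV (\<lambda>x v. margin_weight (HS n) x v) (\<lambda>_. 1) at_top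
     \<and> uniform_limit UNIV (\<lambda>x v. margin_weight (HS n) x v) (\<lambda>_. - 1) at_bot
     \<and> (\<forall>x::real. x \<noteq> 0 \<longrightarrow> n > 0 \<longrightarrow>
        (x > 0 \<longrightarrow> (\<forall>u. Limsup at_infinity (\<lambda>v. ereal (margin_weight (HS n) x v))
                        < ereal (margin_weight Yule_Y x u))) \<and>
        (x < 0 \<longrightarrow> (\<forall>u. Liminf at_infinity (\<lambda>v. ereal (margin_weight (HS n) x v))
                        > ereal (margin_weight Yule_Y x u))))
     \<and> (\<exists>F :: ereal \<times> ereal \<times> ereal \<Rightarrow> real. continuous_on UNIV F \<and>
          (\<forall>x y z. F (ereal x, ereal y, ereal z) = HS n (Psi (x, y, z))))
     \<and> (\<exists>G :: table \<Rightarrow> real. continuous_on (closure tables - Collect zero_row_or_column) G \<and>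
          (\<forall>t\<in>tables. G t = HS n t))
     \<and> (\<forall>t \<in> closure tables \<inter> Collect zero_row_or_column.
          \<not> (\<exists>l. (HS n \<longlongrightarrow> l) (at t within tables)))
     \<and> (\<forall>t\<in>tables. diagonal_table t \<longrightarrow>
          HS n t = Yule_Y t \<and> HS n t = D_prime t \<and> HS n t = corr_r t)"
proof -
  have W: "lambert_W (1 / exp 1) > 0" by (metis lambert_W_inverse_e)
  have below: "(x \<in> {- 1 - lambert_W (1 / exp 1) <..< 1 + lambert_W (1 / exp 1)} \<longrightarrow>
             (x > 0 \<longrightarrow> only_max_at (margin_weight (HS n) x) (0, 0)) \<and>
             (x < 0 \<longrightarrow> only_min_at (margin_weight (HS n) x) (0, 0)))" if "n > 0" for x
  proof (intro impI conjI)
    assume x: "x \<in> {- 1 - lambert_W (1 / exp 1) <..< 1 + lambert_W (1 / exp 1)}"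
    show "only_max_at (margin_weight (HS n) x) (0, 0)" if "x > 0"
      using x by (intro only_max_at_origin[OF \<open>n > 0\<close> that] threshold(1)[OF that]) simp
    show "only_min_at (margin_weight (HS n) x) (0, 0)" if "x < 0"
    proof -
      have x': "- x > 0" using that by simp
      have "only_max_at (margin_weight (HS n) (- x)) (0, 0)"
        using x by (intro only_max_at_origin[OF \<open>n > 0\<close> x'] threshold(1)[OF x']) simp
      then show ?thesis
        unfolding only_min_at_def margin_weight_flip_snd[of n x] minus_minus
        by (rule only_max_at_flip_snd)
    qed
  qed
  have above: "(x < - 1 - lambert_W (1 / exp 1) \<or> x > 1 + lambert_W (1 / exp 1) \<longrightarrow>
             saddle_point (margin_weight (HS n) x) (0, 0) \<and>
             card {v. v \<noteq> (0, 0) \<and> local_extremum (margin_weight (HS n) x) v} = 2 \<and>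
             (\<forall>y z. (y, z) \<noteq> (0, 0) \<and> local_extremum (margin_weight (HS n) x) (y, z) \<longrightarrow>
                one_small_entry (Psi (x, y, z))))" (is "_ \<longrightarrow> ?C") if "n > 0" for x
  proof (rule impI, elim disjE)
    assume "x < - 1 - lambert_W (1 / exp 1)"
    then have x: "x < 0" "- x > 0" "- x > 1 + lambert_W (1 / exp 1)" using W by simp_all
    note neg = saddle_and_extrema_neg[OF \<open>n > 0\<close> x(1) threshold(2)[OF x(2,3)]]
    show ?C using neg by blast
  next
    assume a: "x > 1 + lambert_W (1 / exp 1)"
    then have x: "x > 0" using W by simp
    note pos = saddle_and_extrema_pos[OF \<open>n > 0\<close> x threshold(2)[OF x a]]
    show ?C using pos by blast
  qed
  have limits: "uniform_limit UNIV (\<lambda>y z. margin_weight (HS n) x (y, z))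
          (\<lambda>z. HS_limit n x (inverse (1 + exp (x + z)))) at_top \<and>
        uniform_limit UNIV (\<lambda>y z. margin_weight (HS n) x (y, z))
          (\<lambda>z. HS_limit n x (inverse (1 + exp (x - z)))) at_bot \<and>
        uniform_limit UNIV (\<lambda>z y. margin_weight (HS n) x (y, z))
          (\<lambda>y. HS_limit n x (inverse (1 + exp (x + y)))) at_top \<and>
        uniform_limit UNIV (\<lambda>z y. margin_weight (HS n) x (y, z))
          (\<lambda>y. HS_limit n x (inverse (1 + exp (x - y)))) at_bot \<and>
        (\<forall>w. inverse (1 + exp (x + w)) = 1 / 2 \<longleftrightarrow> w = - x) \<and>
        local_extremum (\<lambda>w. HS_limit n x (inverse (1 + exp (x + w)))) (- x) \<and>
        (\<forall>w. inverse (1 + exp (x - w)) = 1 / 2 \<longleftrightarrow> w = x) \<and>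
        local_extremum (\<lambda>w. HS_limit n x (inverse (1 + exp (x - w)))) x" for x
    unfolding inverse_exp_add_half
    by (intro conjI allI margin_weight_uniform_limits[OF assms]
        local_extremum_HS_limit[OF assms] inverse_exp_add_bounds) auto
  \<comment> \<open>The nine conjuncts are (a), (b), two for (c), (d), (e), two for (f), and
    (g).\<close>
  show ?thesis
    apply (intro conjI)
    subgoal by (intro allI impI conjI[OF below above])
    subgoal by (intro allI impI) (rule limits)
    subgoal by (rule margin_weight_uniform_limit_x[OF assms])
    subgoal by (rule margin_weight_uniform_limit_x[OF assms])
    subgoal by (intro allI impI conjI) (rule HS_downweights_margins; assumption)+
    subgoal by (rule HS_extends_compactification[OF assms])
    subgoal by (rule HS_extends_closure)
    subgoal by (rule ballI, rule HS_no_limit[OF assms]) auto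
    subgoal by (intro ballI impI conjI measures_at_diagonal_tables)
    done
qed

end
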